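(* Let $\kappa$ be an uncountable cardinal with $\kappa^{<\kappa}=\kappa$. Suppose that $E$ is a strongly $\kappa$-bianalytic equivalence relation on ${}^\kappa2$ that contradicts Silver's dichotomy in some $\mathrm{Add}(\kappa,1)$-generic extension. Then $G_E$ is a counterexample to the $G_0^\kappa$-dichotomy, i.e. $G_E$ admits no $\kappa$-Borel measurable coloring with at most $\kappa$ many colors and there is no continuous homomorphism from $G_0^\kappa$ to $G_E$.
   Context: ${}^\kappa 2$ is the set of functions $\kappa\to\{0,1\}$ with the bounded topology, whose basic open sets are $N_t=\{x\in{}^\kappa 2\mid t\subseteq x\}$ for $t\in{}^{<\kappa}2$ (binary sequences of length $<\kappa$). The $\kappa$-Borel sets form the smallest class containing the open sets and closed under complements and unions of length $\kappa$. A $\kappa$-analytic subset of $({}^\kappa2)^n$ is the projection of a closed subset of $({}^\kappa2)^{n+1}$, i.e. of the form $p[T]$ for the set of branches through a tree $T$ of initial segments; a $\kappa$-coanalytic set is the complement of a $\kappa$-analytic set. $\mathrm{Add}(\kappa,1)$ is the forcing ${}^{<\kappa}2$ ordered by end extension. A subset $A$ of $({}^\kappa2)^n$ is strongly $\kappa$-bianalytic if it is both $\kappa$-analytic and $\kappa$-coanalytic and the definitions remain equivalent in $\mathrm{Add}(\kappa,1)$-generic extensions (i.e. there are trees $T,T'$ with $A=p[T]=({}^\kappa2)^n\setminus p[T']$ such that $p[T]=({}^\kappa2)^n\setminus p[T']$ also holds in every $\mathrm{Add}(\kappa,1)$-generic extension). In such extensions, $A$ is interpreted via these definitions. Silver's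 dichotomy for an equivalence relation on ${}^\kappa2$ states that it either has at most $\kappa$ equivalence classes, or there exists a $\kappa$-perfect set of pairwise inequivalent elements of ${}^\kappa2$. A $\kappa$-perfect set is one of the form $[T]=\{x\in{}^\kappa2\mid\forall\alpha<\kappa\ x{\upharpoonright}\alpha\in T\}$ for a nonempty $T\subseteq{}^{<\kappa}2$ closed under initial segments and under unions of $\subseteq$-increasing sequences of length $<\kappa$, in which every $t\in T$ has an extension $u\supseteq t$ in $T$ with $u^\frown0,u^\frown1\in T$. $G_E=({}^\kappa2\times{}^\kappa2)\setminus E$. A graph on $X$ is a symmetric subset of $(X\times X)\setminus\{(x,x)\mid x\in X\}$. A $\kappa$-Borel measurable coloring of a graph $G$ on $X$ with at most $\kappa$ colors is a map $c\colon X\to\kappa$ with $c(x)\neq c(y)$ for all $(x,y)\in G$ and all $c^{-1}(\{\alpha\})$ $\kappa$-Borel. A homomorphism from a graph $G$ on $X$ to a graph $H$ on $Y$ is a map $f\colon X\to Y$ with $(f(x),f(y))\in H$ for all $(x,y)\in G$. Fix an upwards dense subset $S$ of ${}^{<\kappa}2$ (every $t\in{}^{<\kappa}2$ is extended by some $u\in S$, $u\supseteq t$) containing at most one sequence of each length $i<\kappa$. $G_0^\kappa=G_0^\kappa(S)$ is the graph on ${}^\kappa2$ whose edges are the pairs $(t^\frown 0^\frown x,\ t^\frown 1^\frown x)$ with $t\in S$ and $x\in{}^\kappa2$ (and their reversals). *)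

theory Defs
  imports "HOL-Analysis.Analysis" "HOL-Library.Countable_Set"
begin

unbundle cardinal_syntax

section \<open>The cardinal and sequences of length below it\<close>

text \<open>
  The cardinal \<open>\<kappa>\<close> is a well-ordered type \<open>'k\<close> each of whose proper initial
  segments has smaller cardinality than \<open>'k\<close>. Elements of \<open>'k\<close> are the ordinals below \<open>\<kappa>\<close>,
  and \<open>{..<a}\<close> is the ordinal \<open>a\<close> as a set.
\<close>

definition uncountable_cardinal :: "'k::wellorder itself \<Rightarrow> bool" where
  "uncountable_cardinal _ \<longleftrightarrow>
     uncountable (UNIV :: 'k set) \<and> (\<forall>a::'k. |{..<a}| <o |UNIV :: 'k set| )"

typedef (overloaded) ('k::wellorder, 'v) seq = "{t :: 'k \<rightharpoonup> 'v. \<exists>a. dom t = {..<a}}"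
  by (rule exI[of _ Map.empty]) (auto intro!: exI[of _ "LEAST a::'k. True"] dest: not_less_Least)

text \<open>\<open>\<kappa>\<^bsup><\<kappa>\<^esup>\<close> is the cardinality of the set of all functions from some \<open>a < \<kappa>\<close> to \<open>\<kappa>\<close>.\<close>

definition weak_power_eq :: "'k::wellorder itself \<Rightarrow> bool" where
  "weak_power_eq _ \<longleftrightarrow> |UNIV :: ('k, 'k) seq set| =o |UNIV :: 'k set|"

instantiation seq :: (wellorder, type) order
begin

definition "s \<le> t \<longleftrightarrow> Rep_seq s \<subseteq>\<^sub>m Rep_seq t"

definition "s < t \<longleftrightarrow> s \<le> t \<and> \<not> t \<le> s" for s t :: "('a, 'b) seq"

instance
  by standard
    (auto simp: less_eq_seq_def less_seq_def Rep_seq_inject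
       intro: map_le_trans dest: map_le_antisym)

end

definition seq_length :: "('k::wellorder, 'v) seq \<Rightarrow> 'k" where
  "seq_length t = (THE a. dom (Rep_seq t) = {..<a})"

definition seq_snoc :: "('k::wellorder, 'v) seq \<Rightarrow> 'v \<Rightarrow> ('k, 'v) seq" where
  "seq_snoc t b = Abs_seq ((Rep_seq t)(seq_length t \<mapsto> b))"

definition seq_restrict :: "('k::wellorder, 'v) seq \<Rightarrow> 'k \<Rightarrow> ('k, 'v) seq" where
  "seq_restrict t a = Abs_seq (Rep_seq t |` {..<a})"

definition fun_restrict :: "('k::wellorder \<Rightarrow> 'v) \<Rightarrow> 'k \<Rightarrow> ('k, 'v) seq" where
  "fun_restrict x a = Abs_seq (\<lambda>i. if i < a then Some (x i) else None)"

text \<open>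
  Ordinal addition below \<open>\<kappa>\<close>: \<open>a + j\<close> is the least ordinal that is at least \<open>a\<close> and
  exceeds every \<open>a + i\<close> with \<open>i < j\<close>.
\<close>

function ord_add :: "'k::wellorder \<Rightarrow> 'k \<Rightarrow> 'k" where
  "ord_add a j = (LEAST c. a \<le> c \<and> (\<forall>i<j. ord_add a i < c))"
  by auto
termination
  by (relation "inv_image {(i, j). i < j} snd") (auto intro: wf)

declare ord_add.simps [simp del]

definition seq_concat :: "('k::wellorder, 'v) seq \<Rightarrow> ('k \<Rightarrow> 'v) \<Rightarrow> 'k \<Rightarrow> 'v" where
  "seq_concat t x i =
     (if i < seq_length t then the (Rep_seq t i) else x (THE j. ord_add (seq_length t) j = i))"

section \<open>The space of functions from the cardinal to 2\<close>

text \<open>Elements of \<open>\<^sup>\<kappa>2\<close> are functions \<open>'k \<Rightarrow> bool\<close>, with \<open>False\<close> for 0 and \<open>True\<close> for 1.\<close>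

definition basic_open :: "('k::wellorder, bool) seq \<Rightarrow> ('k \<Rightarrow> bool) set" where
  "basic_open t = {x. Rep_seq t \<subseteq>\<^sub>m (\<lambda>i. Some (x i))}"

definition bounded_topology :: "('k::wellorder \<Rightarrow> bool) topology" where
  "bounded_topology = topology_generated_by (range basic_open)"

inductive_set kappa_borel :: "('k::wellorder \<Rightarrow> bool) set set" where
  kappa_borel_open: "openin bounded_topology U \<Longrightarrow> U \<in> kappa_borel"
| kappa_borel_compl: "A \<in> kappa_borel \<Longrightarrow> - A \<in> kappa_borel"
| kappa_borel_Union: "(\<And>i::'k. A i \<in> kappa_borel) \<Longrightarrow> (\<Union>i. A i) \<in> kappa_borel"

definition kappa_borel_coloring ::
  "(('k::wellorder \<Rightarrow> bool) \<times> ('k \<Rightarrow> bool)) set \<Rightarrow> (('k \<Rightarrow> bool) \<Rightarrow> 'k) \<Rightarrow> bool" where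
  "kappa_borel_coloring G c \<longleftrightarrow>
     (\<forall>(x, y) \<in> G. c x \<noteq> c y) \<and> (\<forall>a. c -` {a} \<in> kappa_borel)"

definition graph_hom :: "('x \<times> 'x) set \<Rightarrow> ('y \<times> 'y) set \<Rightarrow> ('x \<Rightarrow> 'y) \<Rightarrow> bool" where
  "graph_hom G H f \<longleftrightarrow> (\<forall>(x, y) \<in> G. (f x, f y) \<in> H)"

definition upwards_dense :: "('k::wellorder, bool) seq set \<Rightarrow> bool" where
  "upwards_dense S \<longleftrightarrow> (\<forall>t. \<exists>u\<in>S. t \<le> u)"

definition G0 ::
  "('k::wellorder, bool) seq set \<Rightarrow> (('k \<Rightarrow> bool) \<times> ('k \<Rightarrow> bool)) set" where
  "G0 S = (let D = {(seq_concat (seq_snoc t False) x, seq_concat (seq_snoc t True) x) | t x. t \<in> S}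
           in D \<union> D\<inverse>)"

definition G_E ::
  "(('k \<Rightarrow> bool) \<times> ('k \<Rightarrow> bool)) set \<Rightarrow> (('k \<Rightarrow> bool) \<times> ('k \<Rightarrow> bool)) set" where
  "G_E E = (UNIV \<times> UNIV) - E"

text \<open>Trees for \<open>\<kappa>\<close>-analytic subsets of \<open>\<^sup>\<kappa>2 \<times> \<^sup>\<kappa>2\<close> and their projections \<open>p[T]\<close>.\<close>

type_synonym 'k triple = "('k, bool) seq \<times> ('k, bool) seq \<times> ('k, bool) seq"

definition is_tree :: "'k::wellorder triple set \<Rightarrow> bool" where
  "is_tree T \<longleftrightarrow>
     (\<forall>(s, t, u) \<in> T. seq_length s = seq_length t \<and> seq_length t = seq_length u \<and>
        (\<forall>a. (seq_restrict s a, seq_restrict t a, seq_restrict u a) \<in> T))"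

definition tree_proj :: "'k::wellorder triple set \<Rightarrow> (('k \<Rightarrow> bool) \<times> ('k \<Rightarrow> bool)) set" where
  "tree_proj T = {(x, y). \<exists>z. \<forall>a. (fun_restrict x a, fun_restrict y a, fun_restrict z a) \<in> T}"

section \<open>The forcing relation\<close>

text \<open>
  HOL has no generic extensions as objects, so truth in them is expressed by the forcing
  relation. A sentence of the forcing language is identified with the set (predicate) of
  conditions that force it; the connectives and quantifiers are given by the usual recursive
  clauses of the forcing relation, the other ones being defined from \<open>\<not>\<close>, \<open>\<and>\<close>, \<open>\<forall>\<close>.
  Larger conditions are stronger, in accordance with end extension in \<open>Add(\<kappa>,1)\<close>.
  Quantifiers range over names, or over ground model sets (such as ordinals below \<open>\<kappa>\<close>)
  that occur in formulas through their canonical names.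
\<close>

type_synonym 'p sentence = "'p \<Rightarrow> bool"

definition f_fact :: "bool \<Rightarrow> 'p sentence" where
  "f_fact P = (\<lambda>p. P)"

definition f_not :: "'p::order sentence \<Rightarrow> 'p sentence" ("\<^bold>\<not> _" [40] 40) where
  "(\<^bold>\<not> \<phi>) = (\<lambda>p. \<forall>q\<ge>p. \<not> \<phi> q)"

definition f_and :: "'p sentence \<Rightarrow> 'p sentence \<Rightarrow> 'p sentence" (infixr "\<^bold>\<and>" 35) where
  "(\<phi> \<^bold>\<and> \<psi>) = (\<lambda>p. \<phi> p \<and> \<psi> p)"

definition f_all :: "('x \<Rightarrow> 'p sentence) \<Rightarrow> 'p sentence" (binder "\<^bold>\<forall>" 10) where
  "f_all \<phi> = (\<lambda>p. \<forall>x. \<phi> x p)"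

definition f_or :: "'p::order sentence \<Rightarrow> 'p sentence \<Rightarrow> 'p sentence" (infixr "\<^bold>\<or>" 30) where
  "(\<phi> \<^bold>\<or> \<psi>) = (\<^bold>\<not> (\<^bold>\<not> \<phi> \<^bold>\<and> \<^bold>\<not> \<psi>))"

definition f_imp :: "'p::order sentence \<Rightarrow> 'p sentence \<Rightarrow> 'p sentence" (infixr "\<^bold>\<longrightarrow>" 25) where
  "(\<phi> \<^bold>\<longrightarrow> \<psi>) = (\<^bold>\<not> (\<phi> \<^bold>\<and> \<^bold>\<not> \<psi>))"

definition f_iff :: "'p::order sentence \<Rightarrow> 'p sentence \<Rightarrow> 'p sentence" (infixr "\<^bold>\<longleftrightarrow>" 25) where
  "(\<phi> \<^bold>\<longleftrightarrow> \<psi>) = ((\<phi> \<^bold>\<longrightarrow> \<psi>) \<^bold>\<and> (\<psi> \<^bold>\<longrightarrow> \<phi>))"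

definition f_ex :: "('x \<Rightarrow> 'p::order sentence) \<Rightarrow> 'p sentence" (binder "\<^bold>\<exists>" 10) where
  "f_ex \<phi> = (\<^bold>\<not> (\<^bold>\<forall>x. \<^bold>\<not> \<phi> x))"

text \<open>
  A \<open>rel_name\<close> is a name for a subset of \<open>\<kappa> \<times> 2\<close>: a pair \<open>((i, b), p)\<close> puts \<open>(i, b)\<close> into the
  named set if \<open>p\<close> is in the generic filter. Every subset of \<open>\<kappa> \<times> 2\<close> in a generic extension,
  in particular every element of \<open>\<^sup>\<kappa>2\<close> and of \<open>\<^bsup><\<kappa>\<^esup>2\<close> (as sets of pairs), has such a name.
  A \<open>set_name\<close> is a name for a set of subsets of \<open>\<kappa> \<times> 2\<close>.
\<close>

type_synonym ('k, 'p) rel_name = "(('k \<times> bool) \<times> 'p) set"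
type_synonym ('k, 'p) set_name = "(('k, 'p) rel_name \<times> 'p) set"

definition f_mem :: "'k \<times> bool \<Rightarrow> ('k, 'p::order) rel_name \<Rightarrow> 'p sentence" where
  "f_mem e \<sigma> = (\<lambda>p. \<forall>q\<ge>p. \<exists>r\<ge>q. \<exists>(e', s) \<in> \<sigma>. s \<le> r \<and> e = e')"

definition f_subset :: "('k, 'p::order) rel_name \<Rightarrow> ('k, 'p) rel_name \<Rightarrow> 'p sentence" where
  "f_subset \<sigma> \<tau> = (\<^bold>\<forall>e. f_mem e \<sigma> \<^bold>\<longrightarrow> f_mem e \<tau>)"

definition f_eq :: "('k, 'p::order) rel_name \<Rightarrow> ('k, 'p) rel_name \<Rightarrow> 'p sentence" where
  "f_eq \<sigma> \<tau> = (\<^bold>\<forall>e. f_mem e \<sigma> \<^bold>\<longleftrightarrow> f_mem e \<tau>)"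

definition f_elem :: "('k, 'p::order) rel_name \<Rightarrow> ('k, 'p) set_name \<Rightarrow> 'p sentence" where
  "f_elem \<sigma> X = (\<lambda>p. \<forall>q\<ge>p. \<exists>r\<ge>q. \<exists>(\<tau>, s) \<in> X. s \<le> r \<and> f_eq \<sigma> \<tau> r)"

definition check :: "('k::wellorder, bool) seq \<Rightarrow> ('k, 'p) rel_name" where
  "check t = {((i, b), p) | i b p. Rep_seq t i = Some b}"

definition name_restrict :: "('k::wellorder, 'p) rel_name \<Rightarrow> 'k \<Rightarrow> ('k, 'p) rel_name" where
  "name_restrict \<sigma> a = {((i, b), p) | i b p. ((i, b), p) \<in> \<sigma> \<and> i < a}"

definition name_insert :: "'k \<times> bool \<Rightarrow> ('k, 'p) rel_name \<Rightarrow> ('k, 'p) rel_name" where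
  "name_insert e \<sigma> = \<sigma> \<union> {e} \<times> UNIV"

text \<open>\<open>f_seq \<sigma> a\<close>: \<open>\<sigma>\<close> is a function \<open>a \<rightarrow> 2\<close>; \<open>f_fun \<sigma>\<close>: \<open>\<sigma> \<in> \<^sup>\<kappa>2\<close>.\<close>

definition f_seq :: "('k::wellorder, 'p::order) rel_name \<Rightarrow> 'k \<Rightarrow> 'p sentence" where
  "f_seq \<sigma> a =
     (\<^bold>\<forall>i. (f_fact (i < a) \<^bold>\<longrightarrow> (f_mem (i, False) \<sigma> \<^bold>\<longleftrightarrow> \<^bold>\<not> f_mem (i, True) \<sigma>)) \<^bold>\<and>
          (f_fact (\<not> i < a) \<^bold>\<longrightarrow> \<^bold>\<not> f_mem (i, False) \<sigma> \<^bold>\<and> \<^bold>\<not> f_mem (i, True) \<sigma>))"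

definition f_fun :: "('k, 'p::order) rel_name \<Rightarrow> 'p sentence" where
  "f_fun \<sigma> = (\<^bold>\<forall>i. f_mem (i, False) \<sigma> \<^bold>\<longleftrightarrow> \<^bold>\<not> f_mem (i, True) \<sigma>)"

section \<open>The relevant notions in generic extensions\<close>

text \<open>\<open>(x, y) \<in> p[T]\<close>, for a tree \<open>T\<close> in the ground model.\<close>

definition f_proj :: "'k::wellorder triple set \<Rightarrow>
    ('k, 'p::order) rel_name \<Rightarrow> ('k, 'p) rel_name \<Rightarrow> 'p sentence" where
  "f_proj T x y =
     (\<^bold>\<exists>z. f_fun z \<^bold>\<and>
       (\<^bold>\<forall>a. \<^bold>\<exists>s. \<^bold>\<exists>t. \<^bold>\<exists>u. f_fact ((s, t, u) \<in> T) \<^bold>\<and>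
          f_eq (name_restrict x a) (check s) \<^bold>\<and>
          f_eq (name_restrict y a) (check t) \<^bold>\<and>
          f_eq (name_restrict z a) (check u)))"

text \<open>
  The conjuncts: \<open>T \<subseteq> \<^bsup><\<kappa>\<^esup>2\<close>; \<open>T\<close> is nonempty; closed under initial segments; closed under
  unions of increasing sequences of length \<open>d < \<kappa>\<close> (only the values \<open>\<tau> i\<close> for \<open>i < d\<close> matter,
  and a sequence of elements of \<open>T\<close> in the extension is given by a sequence of names);
  every element has a splitting extension.
\<close>

definition f_perfect_tree :: "('k::wellorder, 'p::order) set_name \<Rightarrow> 'p sentence" where
  "f_perfect_tree T =
     ((\<^bold>\<forall>t. f_elem t T \<^bold>\<longrightarrow> (\<^bold>\<exists>a. f_seq t a)) \<^bold>\<and>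
      (\<^bold>\<exists>t. f_elem t T) \<^bold>\<and>
      (\<^bold>\<forall>t a. f_elem t T \<^bold>\<longrightarrow> f_elem (name_restrict t a) T) \<^bold>\<and>
      (\<^bold>\<forall>d. \<^bold>\<forall>\<tau> :: 'k \<Rightarrow> ('k, 'p) rel_name.
         (\<^bold>\<forall>i. f_fact (i < d) \<^bold>\<longrightarrow> f_elem (\<tau> i) T) \<^bold>\<and>
         (\<^bold>\<forall>i j. f_fact (i \<le> j \<and> j < d) \<^bold>\<longrightarrow> f_subset (\<tau> i) (\<tau> j)) \<^bold>\<longrightarrow>
         f_elem (\<Union>i\<in>{..<d}. \<tau> i) T) \<^bold>\<and>
      (\<^bold>\<forall>t. f_elem t T \<^bold>\<longrightarrow>
         (\<^bold>\<exists>u. f_elem u T \<^bold>\<and> f_subset t u \<^bold>\<and>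
           (\<^bold>\<exists>a. f_seq u a \<^bold>\<and>
              f_elem (name_insert (a, False) u) T \<^bold>\<and> f_elem (name_insert (a, True) u) T))))"

definition f_branch ::
  "('k::wellorder, 'p::order) rel_name \<Rightarrow> ('k, 'p) set_name \<Rightarrow> 'p sentence" where
  "f_branch x T = (f_fun x \<^bold>\<and> (\<^bold>\<forall>a. f_elem (name_restrict x a) T))"

text \<open>
  Silver's dichotomy for a relation \<open>R\<close> on \<open>\<^sup>\<kappa>2\<close>. That there are at most \<open>\<kappa>\<close> classes is expressed
  by a sequence \<open>\<langle>x \<alpha> | \<alpha> < \<kappa>\<rangle>\<close> whose classes \<open>[x \<alpha>]\<close> exhaust all classes.
\<close>

definition f_at_most_kappa_classes ::
  "(('k::wellorder, 'p::order) rel_name \<Rightarrow> ('k, 'p) rel_name \<Rightarrow> 'p sentence) \<Rightarrow> 'p sentence" where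
  "f_at_most_kappa_classes R =
     (\<^bold>\<exists>x :: 'k \<Rightarrow> ('k, 'p) rel_name.
        (\<^bold>\<forall>a. f_fun (x a)) \<^bold>\<and> (\<^bold>\<forall>y. f_fun y \<^bold>\<longrightarrow> (\<^bold>\<exists>a. R y (x a))))"

definition f_perfect_inequivalent ::
  "(('k::wellorder, 'p::order) rel_name \<Rightarrow> ('k, 'p) rel_name \<Rightarrow> 'p sentence) \<Rightarrow> 'p sentence" where
  "f_perfect_inequivalent R =
     (\<^bold>\<exists>T. f_perfect_tree T \<^bold>\<and>
        (\<^bold>\<forall>x y. f_branch x T \<^bold>\<and> f_branch y T \<^bold>\<and> \<^bold>\<not> f_eq x y \<^bold>\<longrightarrow> \<^bold>\<not> R x y))"

definition f_silver ::
  "(('k::wellorder, 'p::order) rel_name \<Rightarrow> ('k, 'p) rel_name \<Rightarrow> 'p sentence) \<Rightarrow> 'p sentence" where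
  "f_silver R = (f_at_most_kappa_classes R \<^bold>\<or> f_perfect_inequivalent R)"

text \<open>
  Conditions of \<open>Add(\<kappa>,1)\<close> are the elements of \<open>('k, bool) seq\<close>. A sentence holds in every
  (some) generic extension iff every (some) condition forces it.
\<close>

definition in_every_Add_extension :: "('k::wellorder, bool) seq sentence \<Rightarrow> bool" where
  "in_every_Add_extension \<phi> \<longleftrightarrow> (\<forall>p. \<phi> p)"

definition in_some_Add_extension :: "('k::wellorder, bool) seq sentence \<Rightarrow> bool" where
  "in_some_Add_extension \<phi> \<longleftrightarrow> (\<exists>p. \<phi> p)"

type_synonym 'k Add_name = "('k, ('k, bool) seq) rel_name"

definition strongly_bianalytic_via :: "'k::wellorder triple set \<Rightarrow> 'k triple set \<Rightarrow>
    (('k \<Rightarrow> bool) \<times> ('k \<Rightarrow> bool)) set \<Rightarrow> bool" where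
  "strongly_bianalytic_via T T' A \<longleftrightarrow>
     is_tree T \<and> is_tree T' \<and> A = tree_proj T \<and> A = (UNIV \<times> UNIV) - tree_proj T' \<and>
     in_every_Add_extension
       (\<^bold>\<forall>x y :: 'k Add_name. f_fun x \<^bold>\<and> f_fun y \<^bold>\<longrightarrow> (f_proj T x y \<^bold>\<longleftrightarrow> \<^bold>\<not> f_proj T' x y))"

text \<open>
  The relation coded by \<open>T\<close>, interpreted in the extension, contradicts Silver's dichotomy in some
  \<open>Add(\<kappa>,1)\<close>-generic extension.
\<close>

definition silver_fails_in_some_Add_extension :: "'k::wellorder triple set \<Rightarrow> bool" where
  "silver_fails_in_some_Add_extension T \<longleftrightarrow>
     in_some_Add_extension (\<^bold>\<not> f_silver (\<lambda>x y :: 'k Add_name. f_proj T x y))"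

end

theory Submission
  imports Defs
begin

text \<open>
  A condition forcing \<open>(x, y) \<in> p[T]\<close> yields, by \<open><\<kappa>\<close>-closure, actual witnesses in the ground
  model: every point \<open>g\<close> of \<open>\<^sup>\<kappa>2\<close> that meets suitable \<open>\<kappa>\<close> many dense sets evaluates the names
  involved. A coloring makes \<open>E\<close> have at most \<open>\<kappa>\<close> classes in the ground model; a new class in an
  extension would evaluate to a point outside all of them.

  Let \<open>f\<close> be a continuous homomorphism. Were \<open>f x E f y\<close> for almost all \<open>(x, y)\<close> in an open set,
  then \<open>f x E f x'\<close> for some \<open>x\<close> and \<open>x'\<close> which differ in one bit and form an edge. As \<open>E\<close> is
  strongly bianalytic, it follows that \<open>f x\<close> and \<open>f y\<close> are inequivalent for almost all \<open>(x, y)\<close>.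
  A perfect set of such points cannot be built in the ground model in the usual way, since the
  levels of a tree may have size \<open>\<kappa>\<close>. In an \<open>Add(\<kappa>,1)\<close>-generic extension there is a diamond
  sequence, which predicts at level \<open>a\<close> one pair of branches to be separated; any two branches
  are predicted cofinally often. So Silver's dichotomy holds in every extension.
\<close>

text \<open>All evaluation takes place in the ground model: the perfect tree of the extension is
  handled through the ground model trees \<open>tree g\<close>, so \<open>f\<close> is only ever
  applied to ground model points and is never reinterpreted. Two trees are involved: conditions
  \<open>node\<close> in the domain of \<open>f\<close>, and the splitting nodes of their images,
  which span the perfect tree. Two branches are inequivalent once the pair of their preimages lies
  in kappa many dense open sets \<open>U i\<close>. A level \<open>a\<close> with a right guess
  pushes this pair into all \<open>U i\<close> with i \<le> a, so cofinally many right guesses put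
  it into all of them. Right guesses occur cofinally often because of closure points
  \<open>a\<close>, which exist by the uncountable cofinality of kappa: the directions of both
  branches below \<open>a\<close> are determined by \<open>g\<close> below \<open>a\<close>, whereas
  the guess for level \<open>a\<close> is stored at or above \<open>a\<close> and is still
  free.\<close>

section \<open>Agreement of functions below an ordinal; sequences as restrictions of
  functions\<close>

definition agree :: "'k::wellorder \<Rightarrow> ('k \<Rightarrow> 'v) \<Rightarrow> ('k \<Rightarrow> 'v) \<Rightarrow> bool" where
  "agree a x y \<longleftrightarrow> (\<forall>i<a. x i = y i)"

lemma agree_refl [simp]: "agree a x x"
  by (simp add: agree_def)

lemma agree_sym: "agree a x y \<Longrightarrow> agree a y x"
  by (simp add: agree_def)

lemma agree_trans: "agree a x y \<Longrightarrow> agree a y z \<Longrightarrow> agree a x z"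
  by (simp add: agree_def)

lemma agree_mono: "agree a x y \<Longrightarrow> b \<le> a \<Longrightarrow> agree b x y"
  by (auto simp: agree_def)

lemma not_agree_least:
  assumes "\<not> agree a x y"
  obtains i where "i < a" "agree i x y" "x i \<noteq> y i"
proof -
  let ?i = "LEAST i. x i \<noteq> y i"
  obtain j where j: "j < a" "x j \<noteq> y j"
    using assms by (auto simp: agree_def)
  have "x ?i \<noteq> y ?i"
    using j(2) by (rule LeastI)
  moreover have "?i \<le> j"
    using j(2) by (rule Least_le)
  moreover have "agree ?i x y"
    by (auto simp: agree_def dest: not_less_Least)
  ultimately show ?thesis
    using j that by (meson le_less_trans)
qed

lemma lessThan_eq_iff [simp]: "{..<a} = {..<b} \<longleftrightarrow> a = b" for a b :: "'k::linorder"
  by (metis lessThan_iff linorder_less_linear order_less_irrefl)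

lemma dom_Rep_seq: "dom (Rep_seq t) = {..<seq_length t}"
proof -
  obtain a where a: "dom (Rep_seq t) = {..<a}"
    using Rep_seq[of t] by auto
  then have "seq_length t = a"
    by (auto simp: seq_length_def)
  with a show ?thesis by simp
qed

lemma Rep_seq_None_iff: "Rep_seq t i = None \<longleftrightarrow> \<not> i < seq_length t"
  using dom_Rep_seq[of t] by (metis domIff lessThan_iff)

lemma seq_eqI: "(\<And>i. Rep_seq s i = Rep_seq t i) \<Longrightarrow> s = t"
  by (metis Rep_seq_inject ext)

lemma seq_lengthI: "(\<And>i. Rep_seq t i = None \<longleftrightarrow> \<not> i < a) \<Longrightarrow> seq_length t = a"
  by (metis Rep_seq_None_iff linorder_less_linear order_less_irrefl)

text \<open>Beyond the length of \<open>t\<close> the value is the unspecified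
  \<open>the None\<close>. Being total, \<open>seq_at t\<close> serves as the standard point of
  \<open>basic_open t\<close> wherever some point of a cone is wanted.\<close>

definition seq_at :: "('k::wellorder, 'v) seq \<Rightarrow> 'k \<Rightarrow> 'v" where
  "seq_at t i = the (Rep_seq t i)"

lemma Rep_seq_eq: "Rep_seq t i = (if i < seq_length t then Some (seq_at t i) else None)"
  using Rep_seq_None_iff[of t i] by (auto simp: seq_at_def)

lemma Rep_fun_restrict: "Rep_seq (fun_restrict x a) = (\<lambda>i. if i < a then Some (x i) else None)"
  unfolding fun_restrict_def by (rule Abs_seq_inverse) (auto simp: dom_def split: if_splits)

lemma seq_length_fun_restrict [simp]: "seq_length (fun_restrict x a) = a"
  by (rule seq_lengthI) (simp add: Rep_fun_restrict)

lemma seq_at_fun_restrict [simp]: "i < a \<Longrightarrow> seq_at (fun_restrict x a) i = x i"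
  by (simp add: seq_at_def Rep_fun_restrict)

lemma fun_restrict_seq_at [simp]: "fun_restrict (seq_at t) (seq_length t) = t"
  by (rule seq_eqI) (simp add: Rep_fun_restrict Rep_seq_eq)

lemma Rep_seq_restrict: "Rep_seq (seq_restrict t a) = Rep_seq t |` {..<a}"
proof -
  have "dom (Rep_seq t |` {..<a}) = {..<min a (seq_length t)}"
    by (auto simp: dom_Rep_seq)
  then show ?thesis
    unfolding seq_restrict_def by (intro Abs_seq_inverse) auto
qed

lemma seq_le_iff:
  "s \<le> t \<longleftrightarrow> seq_length s \<le> seq_length t \<and> (\<forall>i<seq_length s. seq_at s i = seq_at t i)"
proof
  assume "s \<le> t"
  then have *: "Rep_seq t i = Rep_seq s i" if "i < seq_length s" for i
    using that by (auto simp: less_eq_seq_def map_le_def dom_Rep_seq)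
  then have "i < seq_length t" if "i < seq_length s" for i
    using that by (metis Rep_seq_None_iff)
  then have "seq_length s \<le> seq_length t"
    by (metis leI less_irrefl)
  with * show "seq_length s \<le> seq_length t \<and> (\<forall>i<seq_length s. seq_at s i = seq_at t i)"
    by (simp add: seq_at_def)
next
  assume "seq_length s \<le> seq_length t \<and> (\<forall>i<seq_length s. seq_at s i = seq_at t i)"
  then show "s \<le> t"
    by (auto simp: less_eq_seq_def map_le_def dom_Rep_seq Rep_seq_eq)
qed

lemma seq_le_lengthD: "s \<le> t \<Longrightarrow> seq_length s \<le> seq_length t"
  by (simp add: seq_le_iff)

lemma seq_restrict_le: "seq_restrict t a \<le> t"
  by (auto simp: less_eq_seq_def Rep_seq_restrict map_le_def)

lemma mem_basic_open_iff: "x \<in> basic_open t \<longleftrightarrow> (\<forall>i<seq_length t. x i = seq_at t i)"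
  by (auto simp: basic_open_def map_le_def dom_Rep_seq Rep_seq_eq)

lemma mem_basic_open_agree: "x \<in> basic_open t \<Longrightarrow> agree (seq_length t) x y \<Longrightarrow> y \<in> basic_open t"
  by (simp add: mem_basic_open_iff agree_def)

lemma basic_open_mono: "s \<le> t \<Longrightarrow> x \<in> basic_open t \<Longrightarrow> x \<in> basic_open s"
  by (auto simp: mem_basic_open_iff seq_le_iff)

lemma mem_basic_open_fun_restrict [simp]: "y \<in> basic_open (fun_restrict x a) \<longleftrightarrow> agree a x y"
  by (auto simp: mem_basic_open_iff agree_def)

lemma le_fun_restrict_iff: "s \<le> fun_restrict x a \<longleftrightarrow> seq_length s \<le> a \<and> x \<in> basic_open s"
  by (auto simp: seq_le_iff mem_basic_open_iff)

lemma seq_at_mem_basic_open [simp]: "seq_at t \<in> basic_open t"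
  by (simp add: mem_basic_open_iff)

lemma basic_open_le:
  assumes "x \<in> basic_open s" "x \<in> basic_open t" "seq_length s \<le> seq_length t"
  shows "s \<le> t"
  using assms by (auto simp: seq_le_iff mem_basic_open_iff)

lemma le_common_comparable:
  assumes "s \<le> u" "t \<le> u" "seq_length s \<le> seq_length t"
  shows "s \<le> (t :: ('k::wellorder, bool) seq)"
  using assms by (auto simp: seq_le_iff)

lemma openin_bounded_topologyD:
  assumes "openin bounded_topology U" "x \<in> U"
  shows "\<exists>a. \<forall>y. agree a x y \<longrightarrow> y \<in> U"
proof -
  have "generate_topology_on (range basic_open) U"
    using assms(1) by (simp add: bounded_topology_def openin_topology_generated_by_iff)
  then show ?thesis
    using assms(2)
  proof (induction arbitrary: x)
    case (Int A B)
    then obtain a b where "\<forall>y. agree a x y \<longrightarrow> y \<in> A" "\<forall>y. agree b x y \<longrightarrow> y \<in> B"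
      by blast
    then show ?case
      by (intro exI[of _ "max a b"]) (meson IntI agree_mono max.cobounded1 max.cobounded2)
  next
    case (Basis A)
    then obtain t where "A = basic_open t" by blast
    with Basis show ?case
      by (metis mem_basic_open_agree)
  qed blast+
qed

section \<open>Regularity and arithmetic of kappa\<close>

locale kappa =
  fixes K :: "'k::wellorder itself"
  assumes unc: "uncountable_cardinal TYPE('k)"
    and wpow: "weak_power_eq TYPE('k)"
begin

lemma infinite_kappa: "infinite (UNIV :: 'k set)"
  using unc uncountable_infinite unfolding uncountable_cardinal_def by blast

lemma segment_less: "|{..<a::'k}| <o |UNIV :: 'k set|"
  using unc by (auto simp: uncountable_cardinal_def)

text \<open>A maximum would leave a proper segment that misses a single point; being infinite, it
  would be as large as the whole type.\<close>

lemma gt_ex: "\<exists>b. (a::'k) < b"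
proof (rule ccontr)
  assume no: "\<nexists>b. a < b"
  have U: "{..<a} \<union> {a} = UNIV"
  proof (intro set_eqI iffI UNIV_I)
    fix x
    show "x \<in> {..<a} \<union> {a}"
      using no by (cases x a rule: linorder_cases) auto
  qed
  have "infinite {..<a}"
  proof
    assume "finite {..<a}"
    then have "finite ({..<a} \<union> {a})" by simp
    then show False using infinite_kappa U by metis
  qed
  then have "\<exists>h. bij_betw h {..<a} (UNIV :: 'k set)"
    using infinite_imp_bij_betw2[of "{..<a}" a] U by metis
  then have "|{..<a}| =o |UNIV :: 'k set|"
    by (rule card_of_ordIso[THEN iffD1])
  then show False
    using segment_less not_ordLess_ordIso by metis
qed

definition Succ :: "'k \<Rightarrow> 'k" where
  "Succ a = (LEAST b. a < b)"

lemma less_Succ: "a < Succ a"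
  unfolding Succ_def using gt_ex by (rule LeastI_ex)

lemma less_Succ_iff: "x < Succ a \<longleftrightarrow> x \<le> a"
proof
  assume "x < Succ a"
  then have "\<not> a < x"
    unfolding Succ_def by (rule not_less_Least)
  then show "x \<le> a" by simp
qed (rule le_less_trans[OF _ less_Succ])

text \<open>Koenig's diagonal argument: otherwise a list of all sequences of length \<open>a\<close> in order type
  \<open>\<kappa>\<close> is cut into \<open>a\<close> pieces of size less than \<open>\<kappa>\<close>, and some sequence avoids the values of the
  \<open>j\<close>-th piece at \<open>j\<close>, for all \<open>j\<close>.\<close>

lemma regular: "\<exists>b::'k. \<forall>j<a::'k. h j < b"
proof (rule ccontr)
  assume "\<nexists>b. \<forall>j<a. h j < b"
  then have unb: "\<And>b. \<exists>j<a. b \<le> h j"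
    by (meson linorder_not_less)
  have "|UNIV :: ('k, 'k) seq set| \<le>o |UNIV :: 'k set|"
    using wpow by (simp add: weak_power_eq_def ordIso_imp_ordLeq)
  then obtain e :: "('k, 'k) seq \<Rightarrow> 'k" where e: "inj e"
    by (auto simp: card_of_ordLeq[symmetric])
  define V where "V j = (\<lambda>i. seq_at (inv e i) j) ` {..<Succ (h j)}" for j
  have "V j \<noteq> UNIV" for j
  proof
    assume "V j = UNIV"
    then have "|UNIV :: 'k set| \<le>o |{..<Succ (h j)}|"
      using card_of_image[of "\<lambda>i. seq_at (inv e i) j" "{..<Succ (h j)}"] by (simp add: V_def)
    then show False
      using segment_less not_ordLess_ordLeq by blast
  qed
  then have "\<exists>v. v \<notin> V j" for j by blast
  then obtain v where v: "\<And>j. v j \<notin> V j" by metis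
  define t where "t = fun_restrict v a"
  obtain j where j: "j < a" "e t \<le> h j"
    using unb by blast
  have "seq_at (inv e (e t)) j \<in> V j"
    unfolding V_def using j by (intro imageI) (simp add: less_Succ_iff)
  then have "v j \<in> V j"
    using e j by (simp add: t_def)
  with v show False by blast
qed

lemma regular_le: "\<exists>b::'k. \<forall>j\<le>a::'k. h j < b"
  using regular[of "Succ a" h] by (simp add: less_Succ_iff)

text \<open>Some proper segment is infinite, for otherwise \<open>card {..<a}\<close> would inject
  an uncountable type into the naturals. A countable sequence can be reindexed along that segment
  and is then bounded by \<open>regular\<close>.\<close>

lemma countable_bounded: "\<exists>b::'k. \<forall>n::nat. h n < b"
proof -
  have "\<exists>a::'k. infinite {..<a}"
  proof (rule ccontr)
    assume "\<nexists>a::'k. infinite {..<a}"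
    then have fin: "finite {..<a}" for a :: 'k by blast
    have "inj (\<lambda>a::'k. card {..<a})"
    proof (rule linorder_injI)
      fix x y :: 'k
      assume "x < y"
      then have "{..<x} \<subset> {..<y}" by auto
      then have "card {..<x} < card {..<y}"
        using fin by (intro psubset_card_mono)
      then show "card {..<x} \<noteq> card {..<y}" by simp
    qed
    then have "countable (UNIV :: 'k set)"
      by (rule countableI)
    then show False
      using unc by (simp add: uncountable_cardinal_def)
  qed
  then obtain a :: 'k where "infinite {..<a}" by blast
  then obtain f :: "nat \<Rightarrow> 'k" where f: "inj f" "range f \<subseteq> {..<a}"
    using infinite_countable_subset by blast
  obtain b where b: "\<forall>j<a. h (inv f j) < b"
    using regular by blast
  have "h n < b" for n
  proof -
    have "f n < a" using f(2) by blast
    then show ?thesis using b f(1) by (metis inv_f_f)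
  qed
  then show ?thesis by blast
qed

text \<open>Omega many closing-off steps above \<open>i\<close>. The limit \<open>a\<close> is the
  least bound of the iterates, so every x < a lies below some \<open>s n\<close>, and
  \<open>h x\<close> is then below the next iterate.\<close>

lemma closure_point:
  fixes h :: "'k \<Rightarrow> 'k"
  shows "\<exists>a. i < a \<and> (\<forall>x<a. h x < a)"
proof -
  define H where "H c = (SOME b. c < b \<and> (\<forall>x\<le>c. h x < b))" for c
  have "\<exists>b. c < b \<and> (\<forall>x\<le>c. h x < b)" for c
  proof -
    obtain b where "\<forall>x\<le>c. h x < b" using regular_le by blast
    moreover obtain d where "c < d" using gt_ex by blast
    ultimately show ?thesis by (intro exI[of _ "max b d"]) (simp add: less_max_iff_disj)
  qed
  then have H: "c < H c \<and> (\<forall>x\<le>c. h x < H c)" for c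
    unfolding H_def by (rule someI_ex)
  define s where "s n = (H ^^ n) i" for n :: nat
  have sS: "s (Suc n) = H (s n)" for n by (simp add: s_def)
  define a where "a = (LEAST b. \<forall>n. s n < b)"
  have a: "\<forall>n. s n < a"
    unfolding a_def by (rule LeastI_ex) (rule countable_bounded)
  show ?thesis
  proof (intro exI conjI allI impI)
    show "i < a" using a[rule_format, of 0] by (simp add: s_def)
    fix x assume "x < a"
    then have "\<not> (\<forall>n. s n < x)" unfolding a_def by (rule not_less_Least)
    then obtain n where "x \<le> s n" by (auto simp: not_less)
    then have "h x < s (Suc n)" using H[of "s n"] by (simp add: sS)
    also have "s (Suc n) < a" using a by blast
    finally show "h x < a" .
  qed
qed

lemma pairing: "\<exists>f :: 'k \<times> 'k \<Rightarrow> 'k. bij f"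
proof -
  have "|UNIV \<times> UNIV :: ('k \<times> 'k) set| =o |UNIV :: 'k set|"
    using infinite_kappa by (rule card_of_Times_same_infinite)
  then show ?thesis
    by (auto simp: card_of_ordIso[symmetric])
qed

lemma bool_pairing: "\<exists>f :: 'k \<times> bool \<Rightarrow> 'k. bij f"
proof -
  obtain a b :: 'k where "a \<noteq> b"
    using gt_ex by (metis less_irrefl)
  then have "inj (\<lambda>x. if x then a else b)"
    by (auto simp: inj_def)
  then have "|UNIV :: bool set| \<le>o |UNIV :: 'k set|"
    by (auto simp: card_of_ordLeq[symmetric])
  then have "|(UNIV :: 'k set) \<times> (UNIV :: bool set)| =o |UNIV :: 'k set|"
    using infinite_kappa by (intro card_of_Times_infinite[THEN conjunct1]) auto
  then show ?thesis
    by (auto simp: card_of_ordIso[symmetric])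
qed

text \<open>Recoding the two bits by two elements of kappa embeds the conditions into the kappa many
  sequences counted by \<open>weak_power_eq\<close>. This allows one dense set to be attached to
  each condition.\<close>

lemma seq_enumeration: "\<exists>f :: 'k \<Rightarrow> ('k, bool) seq. surj f"
proof -
  obtain a b :: 'k where ab: "a \<noteq> b"
    using gt_ex by (metis less_irrefl)
  define F where "F t = fun_restrict (\<lambda>i. if seq_at t i then a else b) (seq_length t)"
    for t :: "('k, bool) seq"
  have "inj F"
  proof (rule injI)
    fix s t assume *: "F s = F t"
    have F_len: "seq_length (F u) = seq_length u" for u
      by (simp add: F_def)
    have F_at: "seq_at (F u) i = (if seq_at u i then a else b)" if "i < seq_length u" for u i
      using that by (simp add: F_def)
    have len: "seq_length s = seq_length t"
      using F_len[of s] F_len[of t] * by simp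
    have "seq_at s i = seq_at t i" if "i < seq_length s" for i
      using F_at[of i s] F_at[of i t] that len * ab by (cases "seq_at s i"; cases "seq_at t i") auto
    then have "s \<le> t" "t \<le> s"
      by (simp_all add: seq_le_iff len)
    then show "s = t" by (rule order_antisym)
  qed
  moreover have "|UNIV :: ('k, 'k) seq set| \<le>o |UNIV :: 'k set|"
    using wpow by (simp add: weak_power_eq_def ordIso_imp_ordLeq)
  then obtain e :: "('k, 'k) seq \<Rightarrow> 'k" where "inj e"
    by (auto simp: card_of_ordLeq[symmetric])
  ultimately have "inj (e \<circ> F)" by (intro inj_compose)
  then show ?thesis by (intro exI[of _ "inv (e \<circ> F)"] inj_imp_surj_inv)
qed

lemma Rep_seq_snoc:
  fixes t :: "('k, 'v) seq"
  shows "Rep_seq (seq_snoc t b) = (Rep_seq t)(seq_length t \<mapsto> b)"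
proof -
  have "dom ((Rep_seq t)(seq_length t \<mapsto> b)) = {..<Succ (seq_length t)}"
    by (simp add: dom_Rep_seq set_eq_iff less_Succ_iff le_less disj_commute)
  then show ?thesis
    unfolding seq_snoc_def by (intro Abs_seq_inverse) auto
qed

lemma seq_length_snoc [simp]: "seq_length (seq_snoc (t :: ('k, 'v) seq) b) = Succ (seq_length t)"
  by (rule seq_lengthI) (simp add: Rep_seq_snoc less_Succ_iff Rep_seq_None_iff le_less)

lemma seq_at_snoc: "seq_at (seq_snoc (t :: ('k, 'v) seq) b) i = (if i = seq_length t then b else seq_at t i)"
  by (simp add: seq_at_def Rep_seq_snoc)

lemma le_seq_snoc: "(t :: ('k, 'v) seq) \<le> seq_snoc t b"
  by (simp add: seq_le_iff seq_at_snoc less_imp_le[OF less_Succ])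

lemma mem_basic_open_snoc:
  "x \<in> basic_open (seq_snoc t b) \<longleftrightarrow> x \<in> basic_open t \<and> x (seq_length (t :: ('k, bool) seq)) = b"
proof -
  have "x \<in> basic_open (seq_snoc t b) \<longleftrightarrow>
      (\<forall>i. i < seq_length t \<or> i = seq_length t \<longrightarrow> x i = (if i = seq_length t then b else seq_at t i))"
    by (simp add: mem_basic_open_iff seq_at_snoc less_Succ_iff le_less)
  also have "\<dots> \<longleftrightarrow> (\<forall>i<seq_length t. x i = seq_at t i) \<and> x (seq_length t) = b"
    by auto
  finally show ?thesis
    by (simp only: mem_basic_open_iff)
qed

subsection \<open>Unions of chains\<close>

text \<open>For a chain this is the union. It is defined for arbitrary families, by reading position
  \<open>i\<close> from the first member long enough, so that recursions can use it before their
  values are known to form a chain.\<close>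

definition seq_lub :: "'k \<Rightarrow> ('k \<Rightarrow> ('k, bool) seq) \<Rightarrow> ('k, bool) seq" where
  "seq_lub d h =
     fun_restrict (\<lambda>i. seq_at (h (LEAST j. j < d \<and> i < seq_length (h j))) i)
       (LEAST c. \<forall>j<d. seq_length (h j) \<le> c)"

text \<open>This is what makes recursions through \<open>seq_lub\<close> admissible in
  \<open>wellorder_rec\<close>.\<close>

lemma seq_lub_cong: "(\<And>i. i < d \<Longrightarrow> h i = h' i) \<Longrightarrow> seq_lub d h = seq_lub d h'"
proof -
  assume *: "\<And>i. i < d \<Longrightarrow> h i = h' i"
  define F where "F h i = (LEAST j. j < d \<and> i < seq_length (h j))"
    for h :: "'k \<Rightarrow> ('k, bool) seq" and i
  have c: "(LEAST c. \<forall>j<d. seq_length (h j) \<le> c) = (LEAST c. \<forall>j<d. seq_length (h' j) \<le> c)"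
    using * by simp
  have F: "F h i = F h' i" for i
    unfolding F_def using * by (metis (mono_tags, lifting))
  have "seq_at (h (F h i)) i = seq_at (h' (F h' i)) i"
    if "i < (LEAST c. \<forall>j<d. seq_length (h j) \<le> c)" for i
  proof -
    have "\<not> (\<forall>j<d. seq_length (h j) \<le> i)" using that by (rule not_less_Least)
    then have "\<exists>j. j < d \<and> i < seq_length (h j)" by (auto simp: not_le)
    then have "F h i < d" unfolding F_def by (metis (mono_tags, lifting) LeastI_ex)
    with * F show ?thesis by simp
  qed
  then show ?thesis
    unfolding seq_lub_def c[symmetric] F_def[symmetric]
    by (intro seq_eqI) (simp add: Rep_fun_restrict)
qed

lemma seq_lub_length_less: "i < seq_length (seq_lub d h) \<Longrightarrow> \<exists>j<d. i < seq_length (h j)"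
  unfolding seq_lub_def seq_length_fun_restrict by (drule not_less_Least) (simp add: not_le)

context
  fixes d :: 'k and h :: "'k \<Rightarrow> ('k, bool) seq"
  assumes chain: "\<And>i j. i \<le> j \<Longrightarrow> j < d \<Longrightarrow> h i \<le> h j"
begin

lemma seq_lub_upper:
  assumes "j < d"
  shows "h j \<le> seq_lub d h"
proof -
  have "\<exists>c. \<forall>j<d. seq_length (h j) \<le> c"
    using regular[of d "\<lambda>j. seq_length (h j)"] less_imp_le by blast
  then have len: "\<forall>j<d. seq_length (h j) \<le> seq_length (seq_lub d h)"
    unfolding seq_lub_def seq_length_fun_restrict by (rule LeastI_ex)
  moreover have "seq_at (h j) i = seq_at (seq_lub d h) i" if i: "i < seq_length (h j)" for i
  proof -
    let ?l = "LEAST j. j < d \<and> i < seq_length (h j)"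
    have l: "?l < d \<and> i < seq_length (h ?l)"
      by (rule LeastI) (use i assms in blast)
    have "h ?l \<le> h j"
      using chain[of ?l j] assms i by (simp add: Least_le)
    then have "seq_at (h j) i = seq_at (h ?l) i"
      using l by (simp add: seq_le_iff)
    moreover have "i < seq_length (seq_lub d h)"
      using len assms i by (meson less_le_trans)
    ultimately show ?thesis
      by (simp add: seq_lub_def)
  qed
  ultimately show ?thesis
    using assms by (simp add: seq_le_iff)
qed

lemma seq_lub_Some_iff:
  "Rep_seq (seq_lub d h) i = Some b \<longleftrightarrow> (\<exists>j<d. Rep_seq (h j) i = Some b)"
proof
  assume L: "Rep_seq (seq_lub d h) i = Some b"
  then have "i < seq_length (seq_lub d h)"
    by (metis Rep_seq_eq option.distinct(1))
  then obtain j where j: "j < d" "i < seq_length (h j)"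
    using seq_lub_length_less by blast
  then have "Rep_seq (h j) i = Rep_seq (seq_lub d h) i"
    using seq_lub_upper[of j] \<open>i < seq_length (seq_lub d h)\<close> by (simp add: seq_le_iff Rep_seq_eq)
  with L j show "\<exists>j<d. Rep_seq (h j) i = Some b" by metis
next
  assume "\<exists>j<d. Rep_seq (h j) i = Some b"
  then show "Rep_seq (seq_lub d h) i = Some b"
    using seq_lub_upper by (metis domI less_eq_seq_def map_le_def)
qed

lemma seq_lub_least:
  assumes "\<And>j. j < d \<Longrightarrow> h j \<le> t"
  shows "seq_lub d h \<le> t"
  unfolding less_eq_seq_def map_le_def
proof
  fix i assume "i \<in> dom (Rep_seq (seq_lub d h))"
  then obtain b where b: "Rep_seq (seq_lub d h) i = Some b" by blast
  then obtain j where "j < d" "Rep_seq (h j) i = Some b"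
    using seq_lub_Some_iff by blast
  with b show "Rep_seq (seq_lub d h) i = Rep_seq t i"
    using assms by (metis domI less_eq_seq_def map_le_def)
qed

end

lemma chain_limit:
  fixes p :: "'k \<Rightarrow> ('k, bool) seq"
  assumes "\<And>i j. i \<le> j \<Longrightarrow> p i \<le> p j"
  shows "\<exists>g. \<forall>i. g \<in> basic_open (p i)"
proof -
  define g where "g i = seq_at (p (LEAST j. i < seq_length (p j))) i" for i
  have "g i = seq_at (p j) i" if "i < seq_length (p j)" for i j
  proof -
    let ?l = "LEAST j. i < seq_length (p j)"
    have "i < seq_length (p ?l)" using that by (rule LeastI)
    moreover have "p ?l \<le> p j" using assms that by (simp add: Least_le)
    ultimately show ?thesis by (simp add: g_def seq_le_iff)
  qed
  then show ?thesis by (auto simp: mem_basic_open_iff)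
qed

end

lemma wellorder_bottom: "\<exists>b::'k::wellorder. \<forall>x. \<not> x < b"
  by (rule exI[of _ "LEAST b. True"]) (blast dest: not_less_Least)

lemma wellorder_rec:
  fixes F :: "('k::wellorder \<Rightarrow> 'a) \<Rightarrow> 'k \<Rightarrow> 'a"
  assumes "\<And>f g x. (\<And>z. z < x \<Longrightarrow> f z = g z) \<Longrightarrow> F f x = F g x"
  shows "\<exists>p. \<forall>i. p i = F p i"
proof -
  have "adm_wf {(x, y). x < y} F"
    unfolding adm_wf_def using assms by blast
  then have "wfrec {(x, y). x < y} F = F (wfrec {(x, y). x < y} F)"
    by (rule wfrec_fixpoint[OF wf])
  then show ?thesis by metis
qed

lemma basic_open_extends:
  assumes "g \<in> basic_open s" "seq_length s \<le> a"
  shows "s \<le> fun_restrict g a"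
  using assms by (simp add: le_fun_restrict_iff)

lemma fun_restrict_agree: "agree a g g' \<Longrightarrow> fun_restrict g a = fun_restrict g' a"
  by (rule seq_eqI) (auto simp: Rep_fun_restrict agree_def)

lemma basic_open_common:
  assumes "g \<in> basic_open p" "g \<in> basic_open q"
  obtains r where "p \<le> r" "q \<le> r" "g \<in> basic_open r"
proof
  let ?r = "fun_restrict g (max (seq_length p) (seq_length q))"
  show "p \<le> ?r" "q \<le> ?r" using assms by (simp_all add: basic_open_extends)
  show "g \<in> basic_open ?r" by simp
qed

text \<open>Continuity one coordinate at a time, the form that fits atomic statements
  \<open>f_mem\<close> about names. Regularity of kappa upgrades it to all coordinates below a bound
  (\<open>continuous_below_agree\<close>).\<close>

definition continuous_below :: "(('k::wellorder \<Rightarrow> bool) \<Rightarrow> ('k \<Rightarrow> bool)) \<Rightarrow> bool" where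
  "continuous_below h \<longleftrightarrow> (\<forall>g i. \<exists>a. \<forall>g'. agree a g g' \<longrightarrow> h g' i = h g i)"

section \<open>Baire category\<close>

context kappa
begin

lemma continuous_map_imp_below:
  fixes f :: "('k \<Rightarrow> bool) \<Rightarrow> ('k \<Rightarrow> bool)"
  assumes "continuous_map bounded_topology bounded_topology f"
  shows "continuous_below f"
  unfolding continuous_below_def
proof (intro allI)
  fix g i
  define t where "t = fun_restrict (f g) (Succ i)"
  have "openin bounded_topology (basic_open t)"
    unfolding bounded_topology_def by (rule topology_generated_by_Basis) simp
  moreover have top: "topspace bounded_topology = (UNIV :: ('k \<Rightarrow> bool) set)"
  proof -
    obtain b :: 'k where b: "\<forall>x. \<not> x < b"
      using wellorder_bottom by blast
    have "basic_open (fun_restrict (f g) b) = UNIV"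
      using b by (auto simp: agree_def)
    then show ?thesis
      unfolding bounded_topology_def topology_generated_by_topspace by blast
  qed
  ultimately have "openin bounded_topology {x. f x \<in> basic_open t}"
    using openin_continuous_map_preimage[OF assms, of "basic_open t"] by simp
  moreover have "g \<in> {x. f x \<in> basic_open t}"
    by (simp add: t_def)
  ultimately have "\<exists>a. \<forall>y. agree a g y \<longrightarrow> y \<in> {x. f x \<in> basic_open t}"
    by (rule openin_bounded_topologyD)
  then obtain a where "\<forall>y. agree a g y \<longrightarrow> f y \<in> basic_open t" by auto
  then show "\<exists>a. \<forall>g'. agree a g g' \<longrightarrow> f g' i = f g i"
    unfolding t_def mem_basic_open_fun_restrict agree_def using less_Succ by metis
qed

lemma continuous_below_agree:
  fixes h :: "('k \<Rightarrow> bool) \<Rightarrow> ('k \<Rightarrow> bool)"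
  assumes "continuous_below h"
  shows "\<exists>a. \<forall>g'. agree a g g' \<longrightarrow> agree b (h g) (h g')"
proof -
  obtain A where A: "\<And>i g'. agree (A i) g g' \<Longrightarrow> h g' i = h g i"
    using assms unfolding continuous_below_def by metis
  obtain a where a: "\<forall>i<b. A i < a"
    using regular by blast
  have "agree b (h g) (h g')" if "agree a g g'" for g'
    unfolding agree_def using A a that by (metis agree_mono less_imp_le)
  then show ?thesis by blast
qed

definition dense_open :: "('k \<Rightarrow> bool) set \<Rightarrow> bool" where
  "dense_open U \<longleftrightarrow> (\<forall>g\<in>U. \<exists>a. \<forall>g'. agree a g g' \<longrightarrow> g' \<in> U) \<and> (\<forall>g a. \<exists>g'\<in>U. agree a g g')"

text \<open>Comeagerness for kappa, standing in for "every generic \<open>g\<close>". No fully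
  generic point exists in the ground model, but an argument about fixed names involves only kappa
  many dense sets, and \<open>baire\<close> provides a point in all of them.\<close>

definition almost_all :: "(('k \<Rightarrow> bool) \<Rightarrow> bool) \<Rightarrow> bool" where
  "almost_all \<phi> \<longleftrightarrow> (\<exists>U :: 'k \<Rightarrow> ('k \<Rightarrow> bool) set. (\<forall>i. dense_open (U i)) \<and> (\<forall>g. (\<forall>i. g \<in> U i) \<longrightarrow> \<phi> g))"

lemma almost_all_mono: "almost_all \<phi> \<Longrightarrow> (\<And>g. \<phi> g \<Longrightarrow> \<psi> g) \<Longrightarrow> almost_all \<psi>"
  unfolding almost_all_def by blast

lemma almost_all_all:
  assumes "\<And>i::'k. almost_all (\<phi> i)"
  shows "almost_all (\<lambda>g. \<forall>i. \<phi> i g)"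
proof -
  have "\<exists>U. \<forall>i. (\<forall>j::'k. dense_open (U i j)) \<and> (\<forall>g. (\<forall>j. g \<in> U i j) \<longrightarrow> \<phi> i g)"
    using assms unfolding almost_all_def by (intro choice allI)
  then obtain U where "\<forall>i. (\<forall>j::'k. dense_open (U i j)) \<and> (\<forall>g. (\<forall>j. g \<in> U i j) \<longrightarrow> \<phi> i g)" ..
  then have U: "dense_open (U i j)" "(\<forall>j. g \<in> U i j) \<Longrightarrow> \<phi> i g" for i j g
    by simp_all
  obtain f :: "'k \<times> 'k \<Rightarrow> 'k" where f: "bij f"
    using pairing by blast
  define V where "V k = (case inv f k of (i, j) \<Rightarrow> U i j)" for k
  have V: "V (f (i, j)) = U i j" for i j
    using f by (simp add: V_def bij_is_inj)
  have "dense_open (V k)" for k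
    unfolding V_def using U(1) by (simp split: prod.split)
  moreover have "\<forall>i. \<phi> i g" if "\<forall>k. g \<in> V k" for g
    using U(2) V that by metis
  ultimately show ?thesis
    unfolding almost_all_def by blast
qed

lemma almost_all_seq:
  assumes "\<And>s::('k, bool) seq. almost_all (\<phi> s)"
  shows "almost_all (\<lambda>g. \<forall>s. \<phi> s g)"
proof -
  obtain f :: "'k \<Rightarrow> ('k, bool) seq" where f: "surj f"
    using seq_enumeration by blast
  have "almost_all (\<lambda>g. \<forall>i. \<phi> (f i) g)"
    using assms by (rule almost_all_all)
  then show ?thesis
    by (rule almost_all_mono) (metis f surj_def)
qed

lemma almost_all_conj:
  assumes "almost_all \<phi>" "almost_all \<psi>"
  shows "almost_all (\<lambda>g. \<phi> g \<and> \<psi> g)"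
proof -
  obtain a b :: 'k where ab: "a \<noteq> b"
    using gt_ex by (metis less_irrefl)
  have "almost_all (\<lambda>g. \<forall>i. (if i = a then \<phi> else \<psi>) g)"
    by (rule almost_all_all) (use assms in simp)
  then show ?thesis
    by (rule almost_all_mono) (metis ab)
qed

lemma almost_all_True: "(\<And>g. \<phi> g) \<Longrightarrow> almost_all \<phi>"
  unfolding almost_all_def dense_open_def by (intro exI[of _ "\<lambda>_. UNIV"]) (meson UNIV_I agree_refl)

lemma almost_all_imp: "(P \<Longrightarrow> almost_all \<phi>) \<Longrightarrow> almost_all (\<lambda>g. P \<longrightarrow> \<phi> g)"
  by (cases P) (auto intro: almost_all_True)

text \<open>One dense open set serves all \<open>q\<close> at once: the points with an initial
  segment that is in \<open>D\<close> or has no extension in \<open>D\<close>. The second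
  alternative is impossible along a \<open>g\<close> through a \<open>q\<close> above which
  \<open>D\<close> is dense.\<close>

lemma almost_all_meets:
  "almost_all (\<lambda>g. \<forall>q. g \<in> basic_open q \<longrightarrow> (\<forall>p\<ge>q. \<exists>r\<ge>p. D r) \<longrightarrow> (\<exists>r. D r \<and> g \<in> basic_open r))"
proof -
  define U where "U = {g. \<exists>a. D (fun_restrict g a) \<or> (\<forall>r\<ge>fun_restrict g a. \<not> D r)}"
  have "dense_open U"
    unfolding dense_open_def
  proof (intro conjI allI ballI)
    fix g assume "g \<in> U"
    then obtain a where "D (fun_restrict g a) \<or> (\<forall>r\<ge>fun_restrict g a. \<not> D r)"
      by (auto simp: U_def)
    then have "g' \<in> U" if "agree a g g'" for g'
      unfolding U_def mem_Collect_eq fun_restrict_agree[OF that] by (rule exI[of _ a])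
    then show "\<exists>a. \<forall>g'. agree a g g' \<longrightarrow> g' \<in> U" by blast
  next
    fix g a
    show "\<exists>g'\<in>U. agree a g g'"
    proof (cases "\<exists>r\<ge>fun_restrict g a. D r")
      case True
      then obtain r where r: "r \<ge> fun_restrict g a" "D r" by blast
      have "seq_at r \<in> basic_open (fun_restrict g a)"
        using r(1) seq_at_mem_basic_open by (rule basic_open_mono)
      then have "agree a g (seq_at r)" by simp
      moreover have "seq_at r \<in> U"
        unfolding U_def using r(2) fun_restrict_seq_at[of r] by (metis (mono_tags, lifting) mem_Collect_eq)
      ultimately show ?thesis by blast
    next
      case False
      then have "g \<in> U" by (auto simp: U_def)
      then show ?thesis by (meson agree_refl)
    qed
  qed
  moreover have "\<exists>r. D r \<and> g \<in> basic_open r"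
    if g: "g \<in> U" and q: "g \<in> basic_open q" and D: "\<forall>p\<ge>q. \<exists>r\<ge>p. D r" for g q
  proof -
    obtain a where a: "D (fun_restrict g a) \<or> (\<forall>r\<ge>fun_restrict g a. \<not> D r)"
      using g by (auto simp: U_def)
    obtain p where p: "q \<le> p" "fun_restrict g a \<le> p"
      using basic_open_common[OF q, of "fun_restrict g a"] by auto
    then obtain r where "r \<ge> p" "D r" using D by blast
    then have "D (fun_restrict g a)"
      using a p by (meson order_trans)
    then show ?thesis
      by (intro exI[of _ "fun_restrict g a"]) simp
  qed
  ultimately show ?thesis
    unfolding almost_all_def by (intro exI[of _ "\<lambda>_. U"]) blast
qed

lemma almost_all_meets_below:
  assumes "\<And>p. p \<ge> q \<Longrightarrow> \<exists>r\<ge>p. D r"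
  shows "almost_all (\<lambda>g. g \<in> basic_open q \<longrightarrow> (\<exists>r. D r \<and> g \<in> basic_open r))"
  using almost_all_meets[of D] by (rule almost_all_mono) (use assms in blast)

text \<open>An involution that preserves agreement below every ordinal pulls dense open sets back to
  dense open sets. It is applied to the flip of a single bit.\<close>

lemma almost_all_comp:
  assumes "almost_all \<phi>"
    and agr: "\<And>a g g'. agree a g g' \<Longrightarrow> agree a (F g) (F g')" and inv: "\<And>g. F (F g) = g"
  shows "almost_all (\<lambda>g. \<phi> (F g))"
proof -
  obtain U :: "'k \<Rightarrow> _" where "(\<forall>i. dense_open (U i)) \<and> (\<forall>g. (\<forall>i. g \<in> U i) \<longrightarrow> \<phi> g)"
    using assms(1) unfolding almost_all_def ..
  then have U: "dense_open (U i)" "(\<forall>i. g \<in> U i) \<Longrightarrow> \<phi> g" for i g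
    by simp_all
  have "dense_open (F -` U i)" for i
    unfolding dense_open_def
  proof (intro conjI allI ballI)
    fix g assume "g \<in> F -` U i"
    then obtain a where "\<forall>g'. agree a (F g) g' \<longrightarrow> g' \<in> U i"
      using U(1)[of i] unfolding dense_open_def by blast
    then show "\<exists>a. \<forall>g'. agree a g g' \<longrightarrow> g' \<in> F -` U i"
      using agr by blast
  next
    fix g a
    obtain g' where g': "g' \<in> U i" "agree a (F g) g'"
      using U(1)[of i] unfolding dense_open_def by blast
    then have "agree a g (F g')"
      using agr inv by metis
    moreover have "F g' \<in> F -` U i"
      using g' inv by simp
    ultimately show "\<exists>g'\<in>F -` U i. agree a g g'" by blast
  qed
  then show ?thesis
    unfolding almost_all_def using U(2) by (intro exI[of _ "\<lambda>i. F -` U i"]) auto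
qed

text \<open>A chain of conditions of length kappa that enters \<open>U i\<close> at stage
  \<open>i\<close>; the union of the earlier conditions is again a condition because
  \<open>regular\<close> bounds their lengths.\<close>

lemma baire:
  fixes q :: "('k, bool) seq"
  assumes "almost_all \<phi>"
  obtains g where "g \<in> basic_open q" "\<phi> g"
proof -
  obtain U :: "'k \<Rightarrow> _" where "(\<forall>i. dense_open (U i)) \<and> (\<forall>g. (\<forall>i. g \<in> U i) \<longrightarrow> \<phi> g)"
    using assms(1) unfolding almost_all_def ..
  then have U: "dense_open (U i)" "(\<forall>i. g \<in> U i) \<Longrightarrow> \<phi> g" for i g
    by simp_all
  have "\<exists>t\<ge>s. \<forall>g\<in>basic_open t. g \<in> U i" for s i
  proof -
    obtain g where g: "g \<in> U i" "agree (seq_length s) (seq_at s) g"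
      using U(1)[of i] unfolding dense_open_def by blast
    then obtain a where a: "\<forall>g'. agree a g g' \<longrightarrow> g' \<in> U i"
      using U(1)[of i] unfolding dense_open_def by blast
    have "g \<in> basic_open s"
      using g(2) by (rule mem_basic_open_agree[OF seq_at_mem_basic_open])
    then have "s \<le> fun_restrict g (max a (seq_length s))"
      by (simp add: basic_open_extends)
    moreover have "\<forall>g'\<in>basic_open (fun_restrict g (max a (seq_length s))). g' \<in> U i"
      using a by (simp add: agree_mono)
    ultimately show ?thesis by blast
  qed
  then have "\<exists>step. \<forall>i s. s \<le> step i s \<and> (\<forall>g\<in>basic_open (step i s). g \<in> U i)"
    by (intro choice allI)
  then obtain step where step: "\<And>s i. s \<le> step i s" "\<And>s i g. g \<in> basic_open (step i s) \<Longrightarrow> g \<in> U i"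
    by auto
  \<comment> \<open>At the least index there is nothing to unite, and \<open>seq_lub\<close> would
    yield the empty sequence; the case distinction makes the chain start at
    \<open>q\<close>.\<close>
  define base where "base p i = (if \<exists>j. j < i then seq_lub i p else q)" for p i
  have "\<exists>p. \<forall>i. p i = step i (base p i)"
  proof (rule wellorder_rec)
    fix f g :: "'k \<Rightarrow> ('k, bool) seq" and x
    assume "\<And>z. z < x \<Longrightarrow> f z = g z"
    then have "seq_lub x f = seq_lub x g"
      by (rule seq_lub_cong)
    then show "step x (base f x) = step x (base g x)"
      by (simp add: base_def)
  qed
  then obtain p where p: "\<And>i. p i = step i (base p i)" by blast
  have chain: "\<forall>j\<le>i. p j \<le> p i" for i
  proof (induction i rule: less_induct)
    case (less i)
    have "p j \<le> p i" if "j < i" for j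
    proof -
      have "p j \<le> seq_lub i p"
        using less that by (intro seq_lub_upper) auto
      also have "\<dots> = base p i"
        using that by (auto simp: base_def)
      also have "\<dots> \<le> p i"
        using step(1) p by metis
      finally show ?thesis .
    qed
    then show ?case by (auto simp: le_less)
  qed
  then obtain g where g: "\<And>i. g \<in> basic_open (p i)"
    using chain_limit[of p] by blast
  have "g \<in> U i" for i
    using g step(2) p by metis
  moreover have "g \<in> basic_open q"
  proof -
    obtain b :: 'k where b: "\<not> (\<exists>j. j < b)"
      using wellorder_bottom by blast
    have "q \<le> p b"
      using p[of b] step(1)[of q b] b by (simp add: base_def)
    then show ?thesis using g by (rule basic_open_mono)
  qed
  ultimately show thesis using U(2) that by blast
qed

text \<open>This is the \<open><\<kappa>\<close>-closure of the forcing.\<close>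

lemma meet_few:
  fixes q :: "('k, bool) seq"
  assumes dense: "\<And>i p. i < d \<Longrightarrow> p \<ge> q \<Longrightarrow> \<exists>r\<ge>p. D i r"
    and up: "\<And>i p r. i < d \<Longrightarrow> D i p \<Longrightarrow> p \<le> r \<Longrightarrow> D i r"
  shows "\<exists>r\<ge>q. \<forall>i<(d::'k). D i r"
proof -
  have "almost_all (\<lambda>g. \<forall>i. i < d \<longrightarrow> g \<in> basic_open q \<longrightarrow> (\<exists>r. D i r \<and> g \<in> basic_open r))"
    by (intro almost_all_all almost_all_imp almost_all_meets_below dense)
  then obtain g where g: "g \<in> basic_open q" "\<And>i. i < d \<Longrightarrow> \<exists>r. D i r \<and> g \<in> basic_open r"
    by (rule baire[of _ q]) blast
  then obtain R where R: "\<And>i. i < d \<Longrightarrow> D i (R i) \<and> g \<in> basic_open (R i)"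
    by metis
  obtain b where b: "\<forall>i<d. seq_length (R i) < b"
    using regular by blast
  let ?r = "fun_restrict g (max b (seq_length q))"
  have "q \<le> ?r" using g(1) by (simp add: basic_open_extends)
  moreover have "R i \<le> ?r" if "i < d" for i
    using R b that by (intro basic_open_extends) (auto simp: le_max_iff_disj)
  then have "\<forall>i<d. D i ?r" using R up by blast
  ultimately show ?thesis by blast
qed

end

section \<open>The forcing relation\<close>

definition persistent :: "'p::order sentence \<Rightarrow> bool" where
  "persistent \<phi> \<longleftrightarrow> (\<forall>p q. p \<le> q \<longrightarrow> \<phi> p \<longrightarrow> \<phi> q)"

text \<open>These are the regular open sets of conditions: what is forced densely above
  \<open>p\<close> is forced by \<open>p\<close>. For such sentences the connectives, introduced
  through negation, regain their direct reading (\<open>f_imp_iff\<close>,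
  \<open>f_iff_iff\<close>).\<close>

definition regular_sentence :: "'p::order sentence \<Rightarrow> bool" where
  "regular_sentence \<phi> \<longleftrightarrow> persistent \<phi> \<and> (\<forall>p. (\<forall>q\<ge>p. \<exists>r\<ge>q. \<phi> r) \<longrightarrow> \<phi> p)"

lemma persistentD: "persistent \<phi> \<Longrightarrow> \<phi> p \<Longrightarrow> p \<le> q \<Longrightarrow> \<phi> q"
  by (auto simp: persistent_def)

lemma regular_persistent [simp]: "regular_sentence \<phi> \<Longrightarrow> persistent \<phi>"
  by (simp add: regular_sentence_def)

lemma regular_sentenceD: "regular_sentence \<phi> \<Longrightarrow> (\<And>q. p \<le> q \<Longrightarrow> \<exists>r\<ge>q. \<phi> r) \<Longrightarrow> \<phi> p"
  by (simp add: regular_sentence_def)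

lemma persistent_not [simp]: "persistent (\<^bold>\<not> \<phi>)"
  unfolding persistent_def f_not_def by (meson order_trans)

lemma regular_not [simp]: "persistent \<phi> \<Longrightarrow> regular_sentence (\<^bold>\<not> \<phi>)"
  unfolding regular_sentence_def using persistent_not
  by (auto simp: f_not_def persistent_def) (meson order_refl order_trans)

lemma persistent_and [simp]: "persistent \<phi> \<Longrightarrow> persistent \<psi> \<Longrightarrow> persistent (\<phi> \<^bold>\<and> \<psi>)"
  by (auto simp: persistent_def f_and_def)

lemma regular_and [simp]:
  assumes "regular_sentence \<phi>" "regular_sentence \<psi>"
  shows "regular_sentence (\<phi> \<^bold>\<and> \<psi>)"
  unfolding regular_sentence_def
proof (intro conjI allI impI)
  fix p assume *: "\<forall>q\<ge>p. \<exists>r\<ge>q. (\<phi> \<^bold>\<and> \<psi>) r"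
  have "\<phi> p"
    using assms(1) by (rule regular_sentenceD) (use * in \<open>auto simp: f_and_def\<close>)
  moreover have "\<psi> p"
    using assms(2) by (rule regular_sentenceD) (use * in \<open>auto simp: f_and_def\<close>)
  ultimately show "(\<phi> \<^bold>\<and> \<psi>) p" by (simp add: f_and_def)
qed (simp add: assms)

lemma persistent_all [simp]: "(\<And>x. persistent (\<phi> x)) \<Longrightarrow> persistent (f_all \<phi>)"
  unfolding persistent_def f_all_def by blast

lemma regular_all [simp]:
  assumes "\<And>x. regular_sentence (\<phi> x)"
  shows "regular_sentence (f_all \<phi>)"
  unfolding regular_sentence_def
proof (intro conjI allI impI)
  fix p assume *: "\<forall>q\<ge>p. \<exists>r\<ge>q. f_all \<phi> r"
  have "\<phi> x p" for x
    using assms by (rule regular_sentenceD) (use * in \<open>auto simp: f_all_def\<close>)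
  then show "f_all \<phi> p" by (simp add: f_all_def)
qed (simp add: assms)

lemma regular_fact [simp]: "regular_sentence (f_fact P)"
  by (auto simp: regular_sentence_def persistent_def f_fact_def)

lemma regular_ex [simp]: "regular_sentence (f_ex \<phi>)"
  unfolding f_ex_def by (intro regular_not persistent_all persistent_not)

lemma regular_imp [simp]: "persistent \<phi> \<Longrightarrow> regular_sentence (\<phi> \<^bold>\<longrightarrow> \<psi>)"
  unfolding f_imp_def by simp

lemma regular_iff [simp]: "persistent \<phi> \<Longrightarrow> persistent \<psi> \<Longrightarrow> regular_sentence (\<phi> \<^bold>\<longleftrightarrow> \<psi>)"
  unfolding f_iff_def by simp

lemma f_ex_iff: "f_ex \<phi> p \<longleftrightarrow> (\<forall>q\<ge>p. \<exists>x. \<exists>r\<ge>q. \<phi> x r)"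
  by (simp add: f_ex_def f_not_def f_all_def)

lemma f_and_iff: "(\<phi> \<^bold>\<and> \<psi>) p \<longleftrightarrow> \<phi> p \<and> \<psi> p"
  by (simp add: f_and_def)

lemma f_imp_iff:
  assumes "persistent \<phi>" "regular_sentence \<psi>"
  shows "(\<phi> \<^bold>\<longrightarrow> \<psi>) p \<longleftrightarrow> (\<forall>q\<ge>p. \<phi> q \<longrightarrow> \<psi> q)"
proof
  assume L: "(\<phi> \<^bold>\<longrightarrow> \<psi>) p"
  show "\<forall>q\<ge>p. \<phi> q \<longrightarrow> \<psi> q"
  proof (intro allI impI)
    fix q assume q: "q \<ge> p" "\<phi> q"
    show "\<psi> q"
    proof (rule regular_sentenceD[OF assms(2)])
      fix r assume "q \<le> r"
      then have "p \<le> r" "\<phi> r" using q assms(1) by (auto simp: persistent_def)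
      then show "\<exists>s\<ge>r. \<psi> s" using L by (auto simp: f_imp_def f_not_def f_and_def)
    qed
  qed
next
  assume "\<forall>q\<ge>p. \<phi> q \<longrightarrow> \<psi> q"
  then show "(\<phi> \<^bold>\<longrightarrow> \<psi>) p" by (auto simp: f_imp_def f_not_def f_and_def)
qed

lemma f_iff_iff:
  assumes "regular_sentence \<phi>" "regular_sentence \<psi>"
  shows "(\<phi> \<^bold>\<longleftrightarrow> \<psi>) p \<longleftrightarrow> (\<forall>q\<ge>p. \<phi> q \<longleftrightarrow> \<psi> q)"
  using assms by (auto simp: f_iff_def f_and_def f_imp_iff)

lemma f_fact_imp_iff:
  assumes "regular_sentence \<psi>"
  shows "(f_fact P \<^bold>\<longrightarrow> \<psi>) p \<longleftrightarrow> (P \<longrightarrow> \<psi> p)"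
  using assms by (auto simp: f_imp_iff f_fact_def regular_sentence_def persistent_def)

lemma f_orI1:
  assumes "persistent \<phi>" "\<phi> p"
  shows "(\<phi> \<^bold>\<or> \<psi>) p"
  using assms by (auto simp: f_or_def f_not_def f_and_def persistent_def)

lemma f_orI2:
  assumes "persistent \<psi>" "\<psi> p"
  shows "(\<phi> \<^bold>\<or> \<psi>) p"
  using assms by (auto simp: f_or_def f_not_def f_and_def persistent_def)

lemma regular_mem [simp]: "regular_sentence (f_mem e \<sigma>)"
  unfolding regular_sentence_def persistent_def f_mem_def by (meson order_refl order_trans)

lemma regular_eq [simp]: "regular_sentence (f_eq \<sigma> \<tau>)"
  unfolding f_eq_def by simp

lemma f_eq_iff: "f_eq \<sigma> \<tau> p \<longleftrightarrow> (\<forall>e. \<forall>q\<ge>p. f_mem e \<sigma> q \<longleftrightarrow> f_mem e \<tau> q)"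
  by (simp add: f_eq_def f_all_def f_iff_iff)

lemma f_subset_iff: "f_subset \<sigma> \<tau> p \<longleftrightarrow> (\<forall>e. \<forall>q\<ge>p. f_mem e \<sigma> q \<longrightarrow> f_mem e \<tau> q)"
  by (simp add: f_subset_def f_all_def f_imp_iff)

lemma regular_subset [simp]: "regular_sentence (f_subset \<sigma> \<tau>)"
  unfolding f_subset_def by simp

lemma regular_elem [simp]: "regular_sentence (f_elem \<sigma> X)"
  unfolding regular_sentence_def persistent_def f_elem_def by (meson order_refl order_trans)

lemma regular_fun [simp]: "regular_sentence (f_fun \<sigma>)"
  unfolding f_fun_def by simp

lemma regular_seq [simp]: "regular_sentence (f_seq \<sigma> a)"
  unfolding f_seq_def by simp

lemma regular_proj [simp]: "regular_sentence (f_proj T \<sigma> \<tau>)"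
  unfolding f_proj_def by simp

lemma regular_branch [simp]: "regular_sentence (f_branch \<sigma> X)"
  unfolding f_branch_def by simp

lemmas f_mem_mono = persistentD[OF regular_persistent[OF regular_mem]]
lemmas f_eq_mono = persistentD[OF regular_persistent[OF regular_eq]]
lemmas f_fun_mono = persistentD[OF regular_persistent[OF regular_fun]]

lemma f_fun_iff:
  "f_fun \<sigma> p \<longleftrightarrow> (\<forall>i. \<forall>q\<ge>p. f_mem (i, False) \<sigma> q \<longleftrightarrow> (\<forall>r\<ge>q. \<not> f_mem (i, True) \<sigma> r))"
  by (simp add: f_fun_def f_all_def f_iff_iff) (simp add: f_not_def)

lemma f_fun_unique:
  assumes "f_fun \<sigma> p" "f_mem (i, b) \<sigma> p" "f_mem (i, b') \<sigma> p"
  shows "b = b'"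
  using assms unfolding f_fun_iff by (metis (full_types) order_refl)

lemma f_fun_total:
  assumes "f_fun \<sigma> p" "p \<le> q"
  shows "\<exists>b. \<exists>r\<ge>q. f_mem (i, b) \<sigma> r"
  using assms unfolding f_fun_iff by (meson order_refl)

lemma f_mem_check [simp]: "f_mem (i, b) (check t) p \<longleftrightarrow> Rep_seq t i = Some b"
  unfolding f_mem_def check_def by auto

lemma f_mem_name_restrict [simp]:
  "f_mem (i, b) (name_restrict \<sigma> a) p \<longleftrightarrow> i < a \<and> f_mem (i, b) \<sigma> p"
proof -
  have "(\<exists>(e', s)\<in>name_restrict \<sigma> a. s \<le> r \<and> (i, b) = e') \<longleftrightarrow>
      i < a \<and> (\<exists>(e', s)\<in>\<sigma>. s \<le> r \<and> (i, b) = e')" for r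
    by (auto simp: name_restrict_def)
  then show ?thesis
    unfolding f_mem_def by (cases "i < a") auto
qed

lemma f_eq_check_memD:
  assumes "f_eq \<sigma> (check t) p" "p \<le> q"
  shows "f_mem (i, b) \<sigma> q \<longleftrightarrow> Rep_seq t i = Some b"
  using assms unfolding f_eq_iff by simp

section \<open>Names for the values of continuous functions at the generic point\<close>

text \<open>A name for the value of \<open>h\<close> at the generic point: \<open>s\<close> decides
  coordinate \<open>i\<close> when \<open>h\<close> is constant there on the cone of
  \<open>s\<close>. Constant \<open>h\<close> gives the canonical name of a ground model point;
  \<open>f\<close> composed with \<open>half\<close> gives the image of half of the generic
  point.\<close>

definition name_of :: "(('k::wellorder \<Rightarrow> bool) \<Rightarrow> ('k \<Rightarrow> bool)) \<Rightarrow> 'k Add_name" where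
  "name_of h = {((i, b), s) | i b s. \<forall>g\<in>basic_open s. h g i = b}"

lemma f_mem_name_of:
  assumes "continuous_below h"
  shows "f_mem (i, b) (name_of h) p \<longleftrightarrow> (\<forall>g\<in>basic_open p. h g i = b)"
proof
  assume L: "f_mem (i, b) (name_of h) p"
  show "\<forall>g\<in>basic_open p. h g i = b"
  proof
    fix g assume g: "g \<in> basic_open p"
    obtain a where a: "\<forall>g'. agree a g g' \<longrightarrow> h g' i = h g i"
      using assms unfolding continuous_below_def by blast
    let ?q = "fun_restrict g (max a (seq_length p))"
    have "p \<le> ?q" using g by (simp add: basic_open_extends)
    then obtain r s where r: "r \<ge> ?q" "s \<le> r" "\<forall>g\<in>basic_open s. h g i = b"
      using L unfolding f_mem_def name_of_def by blast
    have "seq_at r \<in> basic_open ?q" "seq_at r \<in> basic_open s"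
      using basic_open_mono[OF r(1)] basic_open_mono[OF r(2)] seq_at_mem_basic_open by blast+
    then have "agree (max a (seq_length p)) g (seq_at r)" "h (seq_at r) i = b"
      using r(3) by simp_all
    moreover from this(1) have "agree a g (seq_at r)"
      by (rule agree_mono) simp
    ultimately show "h g i = b" using a by metis
  qed
next
  assume "\<forall>g\<in>basic_open p. h g i = b"
  then have "((i, b), p) \<in> name_of h" by (simp add: name_of_def)
  then show "f_mem (i, b) (name_of h) p"
    unfolding f_mem_def by blast
qed

lemma f_fun_name_of:
  assumes "continuous_below h"
  shows "f_fun (name_of h) p"
  unfolding f_fun_iff f_mem_name_of[OF assms]
proof (intro allI impI iffI)
  fix i q r
  assume "\<forall>g\<in>basic_open q. h g i = False" "q \<le> r"
  then show "\<not> (\<forall>g\<in>basic_open r. h g i = True)"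
    using basic_open_mono seq_at_mem_basic_open by metis
next
  fix i q
  assume *: "\<forall>r\<ge>q. \<not> (\<forall>g\<in>basic_open r. h g i = True)"
  show "\<forall>g\<in>basic_open q. h g i = False"
  proof (rule ccontr)
    assume "\<not> ?thesis"
    then obtain g where g: "g \<in> basic_open q" "h g i" by auto
    obtain a where a: "\<forall>g'. agree a g g' \<longrightarrow> h g' i = h g i"
      using assms unfolding continuous_below_def by blast
    let ?r = "fun_restrict g (max a (seq_length q))"
    have "q \<le> ?r" using g by (simp add: basic_open_extends)
    moreover have "\<forall>g'\<in>basic_open ?r. h g' i"
      using a g by (simp add: agree_mono)
    ultimately show False using * by auto
  qed
qed

subsection \<open>Evaluation of names at sufficiently generic points\<close>

text \<open>A relation, because at an arbitrary \<open>g\<close> a name may have no value.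
  Uniqueness holds as soon as a condition along \<open>g\<close> forces the name to be a function
  (\<open>interp_unique\<close>); existence is what genericity of \<open>g\<close> provides.\<close>

definition interp :: "'k::wellorder Add_name \<Rightarrow> ('k \<Rightarrow> bool) \<Rightarrow> ('k \<Rightarrow> bool) \<Rightarrow> bool" where
  "interp \<sigma> g x \<longleftrightarrow> (\<forall>i. \<exists>p. g \<in> basic_open p \<and> f_mem (i, x i) \<sigma> p)"

lemma interp_mem:
  assumes "f_fun \<sigma> q" "g \<in> basic_open q" "interp \<sigma> g x" "g \<in> basic_open p" "f_mem (i, b) \<sigma> p"
  shows "x i = b"
proof -
  obtain p' where p': "g \<in> basic_open p'" "f_mem (i, x i) \<sigma> p'"
    using assms(3) unfolding interp_def by blast
  obtain r where r: "p \<le> r" "p' \<le> r" "g \<in> basic_open r"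
    using assms(4) p'(1) by (rule basic_open_common)
  obtain s where s: "r \<le> s" "q \<le> s"
    using r(3) assms(2) by (rule basic_open_common)
  have "f_mem (i, x i) \<sigma> s" "f_mem (i, b) \<sigma> s" "f_fun \<sigma> s"
    using assms(1,5) p'(2) r s by (meson f_mem_mono f_fun_mono)+
  then show ?thesis by (metis f_fun_unique)
qed

lemma interp_unique:
  assumes "f_fun \<sigma> q" "g \<in> basic_open q" "interp \<sigma> g x" "interp \<sigma> g x'"
  shows "x = x'"
proof
  fix i
  obtain p where "g \<in> basic_open p" "f_mem (i, x' i) \<sigma> p"
    using assms(4) unfolding interp_def by blast
  then show "x i = x' i" using assms(1-3) by (metis interp_mem)
qed

lemma interp_name_of:
  assumes "continuous_below h" "interp (name_of h) g x"
  shows "x = h g"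
proof
  fix i
  obtain p where "g \<in> basic_open p" "f_mem (i, x i) (name_of h) p"
    using assms(2) unfolding interp_def by blast
  then show "x i = h g i" using f_mem_name_of[OF assms(1)] by metis
qed

lemma interp_check:
  assumes "interp \<sigma> g x" "g \<in> basic_open r" "f_eq (name_restrict \<sigma> a) (check w) r"
  shows "w = fun_restrict x a"
proof (rule seq_eqI)
  fix i
  obtain p where p: "g \<in> basic_open p" "f_mem (i, x i) \<sigma> p"
    using assms(1) unfolding interp_def by blast
  obtain s where s: "p \<le> s" "r \<le> s"
    using p(1) assms(2) by (rule basic_open_common)
  have mem: "f_mem (i, x i) \<sigma> s" using p(2) s(1) by (rule f_mem_mono)
  have w: "i < a \<and> f_mem (i, b) \<sigma> s \<longleftrightarrow> Rep_seq w i = Some b" for b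
    using f_eq_check_memD[OF assms(3) s(2), of i b] by simp
  show "Rep_seq w i = Rep_seq (fun_restrict x a) i"
  proof (cases "i < a")
    case True
    then have "Rep_seq w i = Some (x i)" using w mem by blast
    with True show ?thesis by (simp add: Rep_fun_restrict)
  next
    case False
    then have "Rep_seq w i \<noteq> Some b" for b using w by blast
    with False show ?thesis by (cases "Rep_seq w i") (auto simp: Rep_fun_restrict)
  qed
qed

context kappa
begin

lemma restrict_check_length:
  fixes r :: "('k, bool) seq"
  assumes "f_fun z r" "g \<in> basic_open r" "g \<in> basic_open r'"
    and eq: "f_eq (name_restrict z a) (check u) r'"
  shows "seq_length u = a"
proof (rule seq_lengthI)
  fix i
  obtain p where p: "r \<le> p" "r' \<le> p"
    using assms(2,3) by (rule basic_open_common)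
  obtain b s where s: "s \<ge> p" "f_mem (i, b) z s"
    using f_fun_total[OF assms(1) p(1)] by blast
  have u: "i < a \<and> f_mem (i, b) z s \<longleftrightarrow> Rep_seq u i = Some b" for b
    using f_eq_check_memD[OF eq, of s i b] p(2) s(1) by simp
  show "Rep_seq u i = None \<longleftrightarrow> \<not> i < a"
    using u s(2) by (metis not_None_eq)
qed

lemma interp_limit:
  fixes g :: "'k \<Rightarrow> bool"
  assumes "\<And>a. g \<in> basic_open (R a)" "\<And>a. f_eq (name_restrict \<sigma> a) (check (s a)) (R a)"
    and len: "\<And>a. seq_length (s a) = a"
  shows "\<exists>x. interp \<sigma> g x \<and> (\<forall>a. s a = fun_restrict x a)"
proof -
  define x where "x i = seq_at (s (Succ i)) i" for i
  have "f_mem (i, x i) \<sigma> (R (Succ i))" for i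
    using f_eq_check_memD[OF assms(2) order_refl, of i "x i" "Succ i"]
    by (simp add: Rep_seq_eq len x_def less_Succ)
  then have "interp \<sigma> g x"
    using assms(1) unfolding interp_def by blast
  then show ?thesis
    using interp_check assms(1,2) by blast
qed

text \<open>The names of the witnesses are chosen below each condition separately, so only \<open>\<kappa>\<close>
  many dense sets are involved, and a point meeting them evaluates the tree's branch in the ground
  model.\<close>

lemma almost_all_proj:
  fixes q :: "('k, bool) seq"
  assumes tree: "is_tree T" and proj: "f_proj T \<sigma> \<tau> q"
  shows "almost_all (\<lambda>g. g \<in> basic_open q \<longrightarrow>
    (\<exists>x y. interp \<sigma> g x \<and> interp \<tau> g y \<and> (x, y) \<in> tree_proj T))"
proof -
  define B where "B z a r \<longleftrightarrow> (\<exists>s t u. (s, t, u) \<in> T \<and> f_eq (name_restrict \<sigma> a) (check s) r \<and>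
      f_eq (name_restrict \<tau> a) (check t) r \<and> f_eq (name_restrict z a) (check u) r)"
    for z :: "'k Add_name" and a r
  define W where "W z p \<longleftrightarrow> f_fun z p \<and> (\<forall>a. \<forall>q\<ge>p. \<exists>r\<ge>q. B z a r)" for z p
  have ex3: "\<exists>r\<ge>q. \<exists>s t u. P s t u r"
    if "f_ex (\<lambda>s. f_ex (\<lambda>t. f_ex (\<lambda>u. P s t u))) p" "q \<ge> p"
    for P :: "'a \<Rightarrow> 'b \<Rightarrow> 'c \<Rightarrow> ('k, bool) seq sentence" and p q
    using that unfolding f_ex_iff by (meson order_refl order_trans)
  have "\<exists>r\<ge>p. \<exists>z. W z r" if "p \<ge> q" for p
  proof -
    have "\<exists>z. \<exists>r\<ge>p. f_fun z r \<and> (\<forall>a. (\<^bold>\<exists>s. \<^bold>\<exists>t. \<^bold>\<exists>u. f_fact ((s, t, u) \<in> T) \<^bold>\<and>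
          f_eq (name_restrict \<sigma> a) (check s) \<^bold>\<and>
          f_eq (name_restrict \<tau> a) (check t) \<^bold>\<and>
          f_eq (name_restrict z a) (check u)) r)"
      using proj that unfolding f_proj_def f_ex_iff[of _ q] f_and_def[of "f_fun _"] f_all_def
      by simp
    then obtain z where "\<exists>r\<ge>p. f_fun z r \<and> (\<forall>a. (\<^bold>\<exists>s. \<^bold>\<exists>t. \<^bold>\<exists>u. f_fact ((s, t, u) \<in> T) \<^bold>\<and>
          f_eq (name_restrict \<sigma> a) (check s) \<^bold>\<and>
          f_eq (name_restrict \<tau> a) (check t) \<^bold>\<and>
          f_eq (name_restrict z a) (check u)) r)" ..
    then obtain r where zr: "r \<ge> p" "f_fun z r"
      and b: "\<And>a. (\<^bold>\<exists>s. \<^bold>\<exists>t. \<^bold>\<exists>u. f_fact ((s, t, u) \<in> T) \<^bold>\<and>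
          f_eq (name_restrict \<sigma> a) (check s) \<^bold>\<and>
          f_eq (name_restrict \<tau> a) (check t) \<^bold>\<and>
          f_eq (name_restrict z a) (check u)) r"
      by (elim exE conjE) (auto simp del: split_paired_Ex)
    have "\<exists>r'\<ge>q. B z a r'" if "q \<ge> r" for a q
      using ex3[OF b that] unfolding B_def f_and_def f_fact_def .
    then have "W z r" using zr unfolding W_def by blast
    with zr show ?thesis by blast
  qed
  then have 1: "almost_all (\<lambda>g. g \<in> basic_open q \<longrightarrow> (\<exists>r. (\<exists>z. W z r) \<and> g \<in> basic_open r))"
    by (rule almost_all_meets_below)
  define zz where "zz r = (SOME z. W z r)" for r
  have 2: "almost_all (\<lambda>g. \<forall>r a. W (zz r) r \<longrightarrow> g \<in> basic_open r \<longrightarrow>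
      (\<exists>r'. B (zz r) a r' \<and> g \<in> basic_open r'))"
    by (intro almost_all_seq almost_all_all almost_all_imp almost_all_meets_below) (simp add: W_def)
  show ?thesis
    using almost_all_conj[OF 1 2]
  proof (rule almost_all_mono, intro impI)
    fix g
    assume g: "(g \<in> basic_open q \<longrightarrow> (\<exists>r. (\<exists>z. W z r) \<and> g \<in> basic_open r)) \<and>
      (\<forall>r a. W (zz r) r \<longrightarrow> g \<in> basic_open r \<longrightarrow> (\<exists>r'. B (zz r) a r' \<and> g \<in> basic_open r'))"
      and q: "g \<in> basic_open q"
    then obtain r where r: "\<exists>z. W z r" "g \<in> basic_open r" by blast
    define z where "z = zz r"
    have W: "W z r" unfolding z_def zz_def using r(1) by (rule someI_ex)
    then have "\<forall>a. \<exists>r'. B z a r' \<and> g \<in> basic_open r'"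
      using g r(2) unfolding z_def by blast
    then obtain R where R: "\<And>a. B z a (R a)" "\<And>a. g \<in> basic_open (R a)" by metis
    obtain s t u where stu: "\<And>a. (s a, t a, u a) \<in> T"
      "\<And>a. f_eq (name_restrict \<sigma> a) (check (s a)) (R a)"
      "\<And>a. f_eq (name_restrict \<tau> a) (check (t a)) (R a)"
      "\<And>a. f_eq (name_restrict z a) (check (u a)) (R a)"
      using R(1) unfolding B_def by metis
    \<comment> \<open>Only the witness \<open>z\<close> is known to be forced to be a function, so
      its segment fixes the length; the tree consists of triples of equal length and passes it on to
      the segments of the other two names.\<close>
    have "seq_length (u a) = a" for a
      using W r(2) R(2) stu(4) unfolding W_def by (metis restrict_check_length)
    moreover have "seq_length (s a) = seq_length (t a) \<and> seq_length (t a) = seq_length (u a)" for a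
      using tree stu(1)[of a] unfolding is_tree_def by fast
    ultimately obtain x y w where x: "interp \<sigma> g x" "\<And>a. s a = fun_restrict x a"
      and y: "interp \<tau> g y" "\<And>a. t a = fun_restrict y a" and w: "\<And>a. u a = fun_restrict w a"
      using interp_limit[OF R(2) stu(2)] interp_limit[OF R(2) stu(3)] interp_limit[OF R(2) stu(4)]
      by auto
    have "(x, y) \<in> tree_proj T"
      using stu(1) unfolding x(2) y(2) w tree_proj_def by blast
    with x(1) y(1) show "\<exists>x y. interp \<sigma> g x \<and> interp \<tau> g y \<and> (x, y) \<in> tree_proj T"
      by blast
  qed
qed

text \<open>Here strong bianalyticity is used: the mere absence of stronger conditions forcing
  membership in p[T] becomes the positive forced statement of membership in p[T'], which
  \<open>almost_all_proj\<close> can evaluate in the ground model.\<close>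

lemma bianalytic_forces_complement:
  fixes T T' :: "'k triple set"
  assumes "strongly_bianalytic_via T T' E" "f_fun \<sigma> q" "f_fun \<tau> (q :: ('k, bool) seq)"
    and no: "\<And>r. r \<ge> q \<Longrightarrow> \<not> f_proj T \<sigma> \<tau> r"
  shows "f_proj T' \<sigma> \<tau> q"
proof -
  have "(f_fun \<sigma> \<^bold>\<and> f_fun \<tau> \<^bold>\<longrightarrow> (f_proj T \<sigma> \<tau> \<^bold>\<longleftrightarrow> \<^bold>\<not> f_proj T' \<sigma> \<tau>)) q"
    using assms(1) unfolding strongly_bianalytic_via_def in_every_Add_extension_def f_all_def by simp
  then have "(f_proj T \<sigma> \<tau> \<^bold>\<longleftrightarrow> \<^bold>\<not> f_proj T' \<sigma> \<tau>) q"
    using assms(2,3) by (auto simp: f_imp_iff f_and_iff)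
  then have iff: "\<forall>p\<ge>q. f_proj T \<sigma> \<tau> p \<longleftrightarrow> (\<^bold>\<not> f_proj T' \<sigma> \<tau>) p"
    by (subst (asm) f_iff_iff) simp_all
  show ?thesis
    using regular_proj
  proof (rule regular_sentenceD)
    fix p assume "q \<le> p"
    then have "\<not> (\<^bold>\<not> f_proj T' \<sigma> \<tau>) p" using iff no by blast
    then show "\<exists>r\<ge>p. f_proj T' \<sigma> \<tau> r" by (simp add: f_not_def)
  qed
qed

section \<open>At most \<open>\<kappa>\<close> classes\<close>

lemma coloring_imp_at_most_kappa_classes:
  fixes T T' :: "'k triple set"
  assumes bi: "strongly_bianalytic_via T T' E"
    and c: "\<And>x y. (x, y) \<notin> E \<Longrightarrow> c x \<noteq> (c y :: 'k)"
  shows "f_at_most_kappa_classes (\<lambda>x y :: 'k Add_name. f_proj T x y) p"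
proof -
  \<comment> \<open>One representative for each color; points of equal color are equivalent. For a
    color that is not attained the value is an arbitrary point.\<close>
  define X where "X a = (SOME y. c y = a)" for a
  have X: "(y, X (c y)) \<in> E" for y
  proof -
    have "c (X (c y)) = c y" unfolding X_def by (rule someI[where x = y]) simp
    then show ?thesis using c by metis
  qed
  have cont: "continuous_below (\<lambda>_. x)" for x :: "'k \<Rightarrow> bool"
    by (simp add: continuous_below_def)
  define N where "N a = name_of (\<lambda>_. X a)" for a
  have N: "f_fun (N a) q" for a q
    unfolding N_def using cont by (rule f_fun_name_of)
  have "\<exists>a. \<exists>r\<ge>q. f_proj T y (N a) r" if y: "f_fun y q" for y q
  proof (rule ccontr)
    assume "\<nexists>a. \<exists>r\<ge>q. f_proj T y (N a) r"
    then have "f_proj T' y (N a) q" for a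
      using bi y N by (intro bianalytic_forces_complement) auto
    moreover have "is_tree T'"
      using bi by (simp add: strongly_bianalytic_via_def)
    ultimately have "almost_all (\<lambda>g. \<forall>a. g \<in> basic_open q \<longrightarrow>
        (\<exists>x x'. interp y g x \<and> interp (N a) g x' \<and> (x, x') \<in> tree_proj T'))"
      by (intro almost_all_all almost_all_proj)
    then obtain g where g: "g \<in> basic_open q"
      and ev: "\<And>a. \<exists>x x'. interp y g x \<and> interp (N a) g x' \<and> (x, x') \<in> tree_proj T'"
      by (rule baire[of _ q]) blast
    obtain x where x: "interp y g x" using ev by blast
    \<comment> \<open>The values supplied by \<open>ev\<close> might depend on \<open>a\<close>;
      uniqueness of evaluation identifies them all with the single \<open>x\<close>, which is thus
      outside every class.\<close>
    have "(x, X a) \<in> tree_proj T'" for a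
      using ev[of a] interp_unique[OF y g x] interp_name_of[OF cont] unfolding N_def by metis
    moreover have "E = UNIV \<times> UNIV - tree_proj T'"
      using bi unfolding strongly_bianalytic_via_def by blast
    ultimately show False using X[of x] by blast
  qed
  then have ex: "(\<^bold>\<exists>a. f_proj T y (N a)) q" if "f_fun y q" for y q
    using that f_fun_mono unfolding f_ex_iff by blast
  have "((\<^bold>\<forall>a. f_fun (N a)) \<^bold>\<and> (\<^bold>\<forall>y. f_fun y \<^bold>\<longrightarrow> (\<^bold>\<exists>a. f_proj T y (N a)))) q" for q
    using N ex by (simp add: f_and_def f_all_def f_imp_iff)
  then show ?thesis
    unfolding f_at_most_kappa_classes_def f_ex_iff[of _ p] by blast
qed

end

section \<open>Edges of the graph\<close>

context kappa
begin

lemma ord_add_props: "(a::'k) \<le> ord_add a j \<and> (\<forall>i<j. ord_add a i < ord_add a j)"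
proof -
  obtain b where "\<forall>i<j. ord_add a i < b"
    using regular by blast
  then have "\<exists>c. a \<le> c \<and> (\<forall>i<j. ord_add a i < c)"
    by (intro exI[of _ "max a b"]) (simp add: less_max_iff_disj)
  then show ?thesis
    unfolding ord_add.simps[of a j] by (rule LeastI_ex)
qed

lemma le_ord_add: "(j::'k) \<le> ord_add a j"
proof (induction j rule: less_induct)
  case (less j)
  show ?case
  proof (rule ccontr)
    assume "\<not> ?case"
    then have *: "ord_add a j < j" by simp
    then have "ord_add a (ord_add a j) < ord_add a j"
      using ord_add_props by blast
    with less[OF *] show False by simp
  qed
qed

text \<open>Ordinal subtraction: at the least \<open>j\<close> where the sum reaches
  \<open>c\<close>, all earlier sums are below \<open>c\<close>, so the recursive minimum is at most
  \<open>c\<close>. This gives the description in \<open>seq_concat\<close> its meaning.\<close>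

lemma ord_add_ex1:
  assumes "(a::'k) \<le> c"
  shows "\<exists>!j. ord_add a j = c"
proof
  let ?j = "LEAST j. c \<le> ord_add a j"
  have "c \<le> ord_add a ?j"
    using le_ord_add by (rule LeastI)
  moreover have "ord_add a ?j \<le> c"
    unfolding ord_add.simps[of a ?j]
    using assms by (intro Least_le) (auto dest: not_less_Least)
  ultimately show "ord_add a ?j = c" by simp
  then show "j = ?j" if "ord_add a j = c" for j
    using that ord_add_props[of a j] ord_add_props[of a ?j]
    by (cases j ?j rule: linorder_cases) auto
qed

lemma seq_concat_eq:
  fixes t :: "('k, bool) seq"
  assumes "x \<in> basic_open t"
  shows "seq_concat t (\<lambda>j. x (ord_add (seq_length t) j)) = x"
proof
  fix i
  show "seq_concat t (\<lambda>j. x (ord_add (seq_length t) j)) i = x i"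
  proof (cases "i < seq_length t")
    case True
    then show ?thesis
      using assms by (simp add: seq_concat_def mem_basic_open_iff Rep_seq_eq)
  next
    case False
    then have "ord_add (seq_length t) (THE j. ord_add (seq_length t) j = i) = i"
      by (intro theI'[OF ord_add_ex1]) simp
    with False show ?thesis by (simp add: seq_concat_def)
  qed
qed

text \<open>The only form in which the graph is used later: edges are flips of one bit, placed at
  the length of an element of \<open>S\<close> along the point. The tail begins at
  \<open>Succ\<close> of that length and does not see the flip.\<close>

lemma G0_edge:
  fixes t :: "('k, bool) seq"
  assumes "t \<in> S" "x \<in> basic_open t"
  shows "(x, x(seq_length t := \<not> x (seq_length t))) \<in> G0 S"
proof -
  let ?l = "seq_length t" and ?w = "\<lambda>j. x (ord_add (Succ (seq_length t)) j)"
  have *: "seq_concat (seq_snoc t b) ?w = x(?l := b)" for b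
  proof -
    have "x(?l := b) \<in> basic_open (seq_snoc t b)"
      using assms(2) by (auto simp: mem_basic_open_snoc[of "x(?l := b)"] mem_basic_open_iff[of _ t])
    moreover have "(\<lambda>j. (x(?l := b)) (ord_add (seq_length (seq_snoc t b)) j)) = ?w"
    proof
      fix j
      have "?l < ord_add (Succ ?l) j"
        using ord_add_props[of "Succ ?l" j] less_Succ[of ?l] by (meson less_le_trans)
      then show "(x(?l := b)) (ord_add (seq_length (seq_snoc t b)) j) = ?w j" by auto
    qed
    ultimately show ?thesis
      using seq_concat_eq[of "x(?l := b)" "seq_snoc t b"] by simp
  qed
  have "(x(?l := False), x(?l := True)) \<in> G0 S" "(x(?l := True), x(?l := False)) \<in> G0 S"
    using assms(1) unfolding G0_def Let_def *[of True, symmetric] *[of False, symmetric] by blast+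
  then show ?thesis
    by (cases "x ?l") (metis (full_types) fun_upd_triv)+
qed

subsection \<open>Pairs of points\<close>

definition bool_pair :: "'k \<times> bool \<Rightarrow> 'k" where
  "bool_pair = (SOME f. bij f)"

lemma bij_bool_pair: "bij bool_pair"
  unfolding bool_pair_def using bool_pairing by (rule someI_ex)

lemma bool_pair_eq_iff [simp]: "bool_pair x = bool_pair y \<longleftrightarrow> x = y"
  using bij_bool_pair by (simp add: bij_is_inj inj_eq)

lemma inv_bool_pair [simp]: "inv bool_pair (bool_pair x) = x"
  using bij_bool_pair by (simp add: bij_is_inj)

text \<open>Interleaving by \<open>bool_pair\<close> identifies the space with its square, so that
  one generic point yields two, and category statements about pairs become statements
  \<open>almost_all\<close> about single points.\<close>

definition half :: "bool \<Rightarrow> ('k \<Rightarrow> bool) \<Rightarrow> 'k \<Rightarrow> bool" where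
  "half b g i = g (bool_pair (i, b))"

lemma bool_pair_bound: "\<exists>c. \<forall>i<a. \<forall>b. bool_pair (i, b) < c"
proof -
  obtain c where "\<forall>i<a. bool_pair (i, True) < c"
    using regular[of a "\<lambda>i. bool_pair (i, True)"] ..
  moreover obtain d where "\<forall>i<a. bool_pair (i, False) < d"
    using regular[of a "\<lambda>i. bool_pair (i, False)"] ..
  ultimately show ?thesis
    by (intro exI[of _ "max c d"]) (simp add: less_max_iff_disj all_bool_eq)
qed

lemma half_agree:
  assumes "\<forall>i<a. \<forall>b. bool_pair (i, b) < c" "agree c g g'"
  shows "agree a (half b g) (half b g')"
  using assms by (simp add: agree_def half_def)

lemma continuous_half:
  assumes "continuous_below f"
  shows "continuous_below (\<lambda>g. f (half b g))"
  unfolding continuous_below_def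
proof (intro allI)
  fix g i
  obtain a where a: "\<forall>x. agree a (half b g) x \<longrightarrow> f x i = f (half b g) i"
    using assms unfolding continuous_below_def by blast
  obtain c where "\<forall>i<a. \<forall>b. bool_pair (i, b) < c"
    using bool_pair_bound by blast
  then show "\<exists>c. \<forall>g'. agree c g g' \<longrightarrow> f (half b g') i = f (half b g) i"
    using a half_agree by blast
qed

text \<open>If a condition forced the images of the two halves to be equivalent, then so would they be
  at a generic point and at the point obtained by flipping one bit of its first half. Choosing the
  bit at the length of an element of \<open>S\<close> contained in that half yields an edge with equivalent
  images.\<close>

lemma almost_all_halves_inequivalent:
  fixes T T' :: "'k triple set"
  assumes bi: "strongly_bianalytic_via T T' E" and E: "equiv UNIV E"
    and S: "upwards_dense S" and f: "continuous_below f"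
    and hom: "graph_hom (G0 S) (G_E E) f"
  shows "almost_all (\<lambda>g. (f (half False g), f (half True g)) \<notin> E)"
proof -
  define h where "h b g = f (half b g)" for b g
  define N where "N b = name_of (h b)" for b
  have cont: "continuous_below (h b)" for b
    unfolding h_def using f by (rule continuous_half)
  have N: "f_fun (N b) q" for b q
    unfolding N_def using cont by (rule f_fun_name_of)
  have eval: "almost_all (\<lambda>g. g \<in> basic_open q \<longrightarrow> (h False g, h True g) \<in> tree_proj U)"
    if "is_tree U" "f_proj U (N False) (N True) q" for U q
    using almost_all_proj[OF that]
    by (rule almost_all_mono) (metis N_def cont interp_name_of)
  have trees: "is_tree T" "is_tree T'" "E = tree_proj T" "E = UNIV \<times> UNIV - tree_proj T'"
    using bi unfolding strongly_bianalytic_via_def by auto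
  have no: "\<not> f_proj T (N False) (N True) r" for r
  proof
    assume "f_proj T (N False) (N True) r"
    then have ae: "almost_all (\<lambda>g. g \<in> basic_open r \<longrightarrow> (h False g, h True g) \<in> E)"
      using eval[OF trees(1)] trees(3) by simp
    define l where "l = seq_length r"
    \<comment> \<open>Above all indices of half-coordinates on which \<open>r\<close> has a say. As
      \<open>u\<close> has length at least \<open>b\<close>, the bit to be flipped lies outside
      \<open>r\<close>.\<close>
    obtain b where b: "\<forall>k<l. fst (inv bool_pair k) < b"
      using regular by blast
    obtain u where u: "u \<in> S" "fun_restrict (half False (seq_at r)) b \<le> u"
      using S unfolding upwards_dense_def by blast
    have lu: "b \<le> seq_length u"
      using u(2) by (auto dest: seq_le_lengthD)
    define c where "c = bool_pair (seq_length u, False)"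
    have c: "l \<le> c"
    proof (rule ccontr)
      assume "\<not> l \<le> c"
      then have "fst (inv bool_pair c) < b" using b by simp
      then show False using lu by (simp add: c_def)
    qed
    \<comment> \<open>A point of \<open>r\<close> whose first half runs through \<open>u\<close>;
      the two demands are compatible since below \<open>b\<close> the sequence \<open>u\<close>
      copies the first half of a point of \<open>r\<close>.\<close>
    define x where "x k = (case inv bool_pair k of (i, j) \<Rightarrow>
        if \<not> j \<and> i < seq_length u then seq_at u i else seq_at r k)" for k
    have xr: "agree l (seq_at r) x"
      unfolding agree_def
    proof (intro allI impI)
      fix k assume k: "k < l"
      obtain i j where ij: "k = bool_pair (i, j)"
        using bij_bool_pair by (metis bij_pointE surj_pair)
      have "i < b" using b k ij by force
      then have "seq_at u i = seq_at r (bool_pair (i, False))"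
        using u(2) by (auto simp: seq_le_iff half_def)
      then show "seq_at r k = x k"
        by (auto simp: x_def ij)
    qed
    have xu: "half False x \<in> basic_open u"
      by (simp add: mem_basic_open_iff half_def x_def)
    obtain d where d: "\<forall>i<seq_length u. \<forall>b. bool_pair (i, b) < d"
      using bool_pair_bound by blast
    define flip where "flip g = g(c := \<not> g c)" for g :: "'k \<Rightarrow> bool"
    have "almost_all (\<lambda>g. flip g \<in> basic_open r \<longrightarrow> (h False (flip g), h True (flip g)) \<in> E)"
      using ae by (rule almost_all_comp) (auto simp: flip_def agree_def)
    \<comment> \<open>The point is good and stays good after the flip. The bound \<open>l\<close>
      keeps it in the cone of \<open>r\<close>, the bound \<open>d\<close> keeps its first half in
      the cone of \<open>u\<close>.\<close>
    then obtain g where g: "g \<in> basic_open (fun_restrict x (max l d))"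
      and gE: "g \<in> basic_open r \<longrightarrow> (h False g, h True g) \<in> E"
      and flE: "flip g \<in> basic_open r \<longrightarrow> (h False (flip g), h True (flip g)) \<in> E"
      by (rule baire[OF almost_all_conj[OF ae], of _ "fun_restrict x (max l d)"]) blast+
    have ag: "agree (max l d) x g" using g by simp
    then have "agree l (seq_at r) g"
      using xr by (meson agree_mono agree_trans max.cobounded1)
    then have gr: "g \<in> basic_open r"
      unfolding l_def by (rule mem_basic_open_agree[OF seq_at_mem_basic_open])
    moreover have "agree l g (flip g)"
      using c by (auto simp: agree_def flip_def)
    ultimately have "flip g \<in> basic_open r"
      unfolding l_def by (rule mem_basic_open_agree)
    then have eq: "(h False g, h True g) \<in> E" "(h False (flip g), h True (flip g)) \<in> E"
      using gr gE flE by auto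
    have same: "half True (flip g) = half True g"
      by (auto simp: half_def flip_def c_def)
    have diff: "half False (flip g) = (half False g)(seq_length u := \<not> half False g (seq_length u))"
      by (auto simp: fun_eq_iff half_def flip_def c_def)
    \<comment> \<open>Both are equivalent to the image of the second half, which the flip leaves
      unchanged.\<close>
    have "(h False g, h False (flip g)) \<in> E"
      using eq E same unfolding h_def by (metis equiv_def symD transD)
    moreover have "half False g \<in> basic_open u"
      using xu half_agree[OF d agree_mono[OF ag]] by (meson max.cobounded2 mem_basic_open_agree)
    then have "(half False g, half False (flip g)) \<in> G0 S"
      unfolding diff using u(1) by (intro G0_edge)
    then have "(f (half False g), f (half False (flip g))) \<in> G_E E"
      using hom unfolding graph_hom_def by blast
    ultimately show False
      by (simp add: h_def G_E_def)
  qed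
  have "f_proj T' (N False) (N True) q" for q
    using bi N no by (intro bianalytic_forces_complement)
  then have ae: "almost_all (\<lambda>g. g \<in> basic_open q \<longrightarrow> (h False g, h True g) \<in> tree_proj T')" for q
    by (intro eval trees)
  obtain b :: 'k where b: "\<forall>x. \<not> x < b"
    using wellorder_bottom by blast
  have all: "g \<in> basic_open (fun_restrict undefined b)" for g
    using b by (simp add: agree_def)
  show ?thesis
  proof (rule almost_all_mono[OF ae[of "fun_restrict undefined b"]])
    fix g
    assume "g \<in> basic_open (fun_restrict undefined b) \<longrightarrow> (h False g, h True g) \<in> tree_proj T'"
    then have "(h False g, h True g) \<in> tree_proj T'"
      using all by blast
    then show "(f (half False g), f (half True g)) \<notin> E"
      unfolding h_def trees(4) by blast
  qed
qed

section \<open>Extending pairs of conditions into dense sets; splitting of images\<close>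

text \<open>A point in every \<open>U i\<close> handles all i \<le> a at once: by openness each
  \<open>U i\<close> needs only an initial segment of it, and regularity bounds these segments as
  well as their traces on the two halves.\<close>

lemma pair_extend:
  assumes U: "\<And>i. dense_open (U i)"
  shows "\<exists>w w'. v \<le> w \<and> v' \<le> w' \<and>
    (\<forall>g. half False g \<in> basic_open w \<longrightarrow> half True g \<in> basic_open w' \<longrightarrow> (\<forall>i\<le>a::'k. g \<in> U i))"
proof -
  define g0 where "g0 k = (case inv bool_pair k of (i, j) \<Rightarrow> if j then seq_at v' i else seq_at v i)" for k
  have g0: "half False g0 = seq_at v" "half True g0 = seq_at v'"
    by (auto simp: half_def g0_def)
  define n where "n = max (seq_length v) (seq_length v')"
  obtain c where c: "\<forall>i<n. \<forall>b. bool_pair (i, b) < c"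
    using bool_pair_bound by blast
  have "almost_all (\<lambda>g. \<forall>i. g \<in> U i)"
    unfolding almost_all_def using U by blast
  then obtain g where g: "g \<in> basic_open (fun_restrict g0 c)" "\<And>i. g \<in> U i"
    by (rule baire) blast
  have ag: "agree n (half b g0) (half b g)" for b
    using half_agree[OF c] g(1) by simp
  have vg: "half False g \<in> basic_open v"
    using ag[of False] unfolding g0 n_def
    by (intro mem_basic_open_agree[OF seq_at_mem_basic_open]) (simp add: agree_mono)
  have vg': "half True g \<in> basic_open v'"
    using ag[of True] unfolding g0 n_def
    by (intro mem_basic_open_agree[OF seq_at_mem_basic_open]) (simp add: agree_mono)
  have "\<forall>i. \<exists>b. \<forall>g'. agree b g g' \<longrightarrow> g' \<in> U i"
    using U g(2) unfolding dense_open_def by blast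
  then obtain L where L: "\<And>i g'. agree (L i) g g' \<Longrightarrow> g' \<in> U i"
    by metis
  obtain l where l: "\<forall>i\<le>a. L i < l"
    using regular_le by blast
  obtain k where k: "\<forall>x<l. fst (inv bool_pair x) < k"
    using regular by blast
  define m where "m = max k n"
  let ?w = "fun_restrict (half False g) m" and ?w' = "fun_restrict (half True g) m"
  have "g' \<in> U i" if *: "half False g' \<in> basic_open ?w" "half True g' \<in> basic_open ?w'" "i \<le> a" for g' i
  proof -
    have "agree l g g'"
      unfolding agree_def
    proof (intro allI impI)
      fix x assume x: "x < l"
      obtain i j where ij: "x = bool_pair (i, j)"
        using bij_bool_pair by (metis bij_pointE surj_pair)
      have "i < m" using k x ij unfolding m_def by (force simp: less_max_iff_disj)
      then show "g x = g' x"
        using *(1,2) unfolding ij by (cases j) (auto simp: agree_def half_def)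
    qed
    then show ?thesis using L l *(3) by (meson agree_mono less_imp_le)
  qed
  moreover have "v \<le> ?w" "v' \<le> ?w'"
    using vg vg' by (auto intro!: basic_open_extends simp: m_def n_def le_max_iff_disj)
  ultimately show ?thesis by blast
qed

text \<open>An extension of \<open>s\<close> in \<open>S\<close> gives an edge inside the cone of
  \<open>s\<close>. Its ends have inequivalent images, which differ because \<open>E\<close> is
  reflexive; \<open>M\<close> is what the images share before their first difference, and continuity
  yields the conditions \<open>e\<close>.\<close>

lemma splitting:
  assumes E: "equiv UNIV E" and S: "upwards_dense S" and f: "continuous_below f"
    and hom: "graph_hom (G0 S) (G_E E) f"
  shows "\<exists>M e. \<forall>j. s \<le> e j \<and> (\<forall>x\<in>basic_open (e j). f x \<in> basic_open (seq_snoc (M :: ('k, bool) seq) j))"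
proof -
  obtain u where u: "u \<in> S" "s \<le> u"
    using S unfolding upwards_dense_def by blast
  define x where "x = seq_at u"
  define y where "y = x(seq_length u := \<not> x (seq_length u))"
  have xu: "x \<in> basic_open u" "y \<in> basic_open u"
    by (simp_all add: x_def y_def mem_basic_open_iff)
  have "(x, y) \<in> G0 S"
    unfolding y_def using u(1) xu(1) by (rule G0_edge)
  then have "(f x, f y) \<notin> E"
    using hom unfolding graph_hom_def G_E_def by blast
  then have "f x \<noteq> f y"
    using E by (metis UNIV_I equiv_def refl_onD)
  then obtain k where "f x k \<noteq> f y k" by blast
  then have "\<not> agree (Succ k) (f x) (f y)"
    unfolding agree_def using less_Succ by blast
  then obtain n where n: "agree n (f x) (f y)" "f x n \<noteq> f y n"
    by (rule not_agree_least)
  define M where "M = fun_restrict (f x) n"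
  \<comment> \<open>Names the ends of the edge by the bit with which their images leave
    \<open>M\<close>.\<close>
  define z where "z j = (if f x n = j then x else y)" for j
  have z: "f (z j) \<in> basic_open (seq_snoc M j)" for j
    using n by (auto simp: z_def M_def mem_basic_open_snoc)
  have "\<forall>j. \<exists>a. \<forall>g'. agree a (z j) g' \<longrightarrow> agree (Succ n) (f (z j)) (f g')"
    using continuous_below_agree[OF f] by blast
  then obtain a where a: "\<And>j g'. agree (a j) (z j) g' \<Longrightarrow> agree (Succ n) (f (z j)) (f g')"
    by metis
  define e where "e j = fun_restrict (z j) (max (a j) (seq_length s))" for j
  have "s \<le> e j" for j
    using xu u(2) unfolding e_def z_def by (auto intro!: basic_open_extends basic_open_mono[of s u])
  moreover have "f x' \<in> basic_open (seq_snoc M j)" if "x' \<in> basic_open (e j)" for x' j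
  proof -
    have "agree (a j) (z j) x'"
      using that by (simp add: e_def agree_mono)
    then have "agree (Succ n) (f (z j)) (f x')" by (rule a)
    then show ?thesis
      using z[of j] by (auto intro: mem_basic_open_agree simp: M_def)
  qed
  ultimately show ?thesis by blast
qed

end

section \<open>Perfect trees\<close>

context kappa
begin

text \<open>\<open>m a b\<close> is the splitting node of level \<open>a\<close> in direction
  \<open>b\<close>. Directions are total functions, of which level \<open>a\<close> sees only the
  part below \<open>a\<close>; this is the role of \<open>m_agree\<close>.\<close>

definition splitting_tree :: "('k \<Rightarrow> ('k \<Rightarrow> bool) \<Rightarrow> ('k, bool) seq) \<Rightarrow> ('k, bool) seq set" where
  "splitting_tree m = {w. \<exists>a b. w \<le> m a b}"

context
  fixes m :: "'k \<Rightarrow> ('k \<Rightarrow> bool) \<Rightarrow> ('k, bool) seq"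
  assumes m_agree: "\<And>a b c. agree a b c \<Longrightarrow> m a b = m a c"
    and m_snoc: "\<And>a b i. i < a \<Longrightarrow> seq_snoc (m i b) (b i) \<le> m a b"
begin

lemma m_mono: "i \<le> a \<Longrightarrow> m i b \<le> m a b"
  using m_snoc le_seq_snoc by (metis order_le_less order_trans)

lemma le_m_length: "a \<le> seq_length (m a b)"
proof (induction a rule: less_induct)
  case (less a)
  show ?case
  proof (rule ccontr)
    assume "\<not> ?case"
    then have *: "seq_length (m a b) < a" by simp
    let ?i = "seq_length (m a b)"
    have "Succ (seq_length (m ?i b)) \<le> seq_length (m a b)"
      using seq_le_lengthD[OF m_snoc[OF *]] by simp
    then have "seq_length (m ?i b) < ?i"
      using less_Succ less_le_trans by blast
    with less[OF *] show False by simp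
  qed
qed

lemma splitting_agree:
  assumes "\<And>i. i < a \<Longrightarrow> x \<in> basic_open (seq_snoc (m i b) (b i))"
    and "\<And>i. i < a \<Longrightarrow> x \<in> basic_open (seq_snoc (m i c) (c i))"
  shows "agree a b c"
proof (rule ccontr)
  assume "\<not> agree a b c"
  then obtain i where i: "i < a" "agree i b c" "b i \<noteq> c i"
    by (rule not_agree_least)
  have "m i b = m i c" using i(2) by (rule m_agree)
  then show False
    using assms[OF i(1)] i(3) by (simp add: mem_basic_open_snoc)
qed

text \<open>Take the least level at which a node contains \<open>w\<close>. If two directions to
  nodes above \<open>w\<close> parted earlier, at a node of level \<open>i\<close>, then
  \<open>w\<close> would either be contained in that node, against minimality, or have both bits
  there.\<close>

lemma splitting_tree_cone:
  assumes "w \<in> splitting_tree m"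
  obtains a b where "w \<le> m a b" "\<And>a' b'. w \<le> m a' b' \<Longrightarrow> a \<le> a' \<and> agree a b b'"
proof -
  let ?a = "LEAST a. \<exists>b. w \<le> m a b"
  have "\<exists>a b. w \<le> m a b"
    using assms by (simp add: splitting_tree_def)
  then have "\<exists>b. w \<le> m ?a b"
    by (rule LeastI_ex)
  then obtain b where b: "w \<le> m ?a b" ..
  have "?a \<le> a' \<and> agree ?a b b'" if w: "w \<le> m a' b'" for a' b'
  proof
    show le: "?a \<le> a'"
      using w by (intro Least_le) blast
    show "agree ?a b b'"
    proof (rule ccontr)
      assume "\<not> agree ?a b b'"
      then obtain i where i: "i < ?a" "agree i b b'" "b i \<noteq> b' i"
        by (rule not_agree_least)
      have eq: "m i b = m i b'" using i(2) by (rule m_agree)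
      have 1: "seq_snoc (m i b) (b i) \<le> m ?a b" "seq_snoc (m i b) (b' i) \<le> m a' b'"
        using m_snoc[OF i(1), of b] m_snoc[of i a' b'] i(1) le eq by simp_all
      have "\<not> (\<exists>b. w \<le> m i b)"
        using i(1) by (rule not_less_Least)
      moreover have "w \<le> m i b"
      proof (cases "seq_length w \<le> seq_length (m i b)")
        case True
        have "m i b \<le> m ?a b" by (rule m_mono[OF less_imp_le[OF i(1)]])
        show ?thesis by (rule le_common_comparable[OF b \<open>m i b \<le> m ?a b\<close> True])
      next
        case False
        then have l: "seq_length (m i b) < seq_length w" by simp
        have "seq_at w (seq_length (m i b)) = j" if "w \<le> u" "seq_snoc (m i b) j \<le> u" for u j
        proof -
          have "seq_at w (seq_length (m i b)) = seq_at u (seq_length (m i b))"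
            using that(1) l by (simp add: seq_le_iff)
          moreover have "seq_at (seq_snoc (m i b) j) (seq_length (m i b)) = seq_at u (seq_length (m i b))"
            using that(2) less_Succ unfolding seq_le_iff by simp
          ultimately show ?thesis by (simp add: seq_at_snoc)
        qed
        then have "b i = b' i" using 1 b w by metis
        with i(3) show ?thesis by simp
      qed
      ultimately show False by blast
    qed
  qed
  with b show thesis by (rule that)
qed

text \<open>Coherent partial directions are glued by reading each position from the first one that
  covers it. \<open>D\<close> is an initial segment of indices: those below \<open>d\<close> for
  unions of chains, all of them for branches.\<close>

lemma cones_union:
  assumes "\<And>i j. i \<le> j \<Longrightarrow> D j \<Longrightarrow> a i \<le> a j \<and> agree (a i) (b i) (b j :: 'k \<Rightarrow> bool)"
    and down: "\<And>i j. (i::'k) \<le> j \<Longrightarrow> D j \<Longrightarrow> D i"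
  shows "\<exists>B. \<forall>i. D i \<longrightarrow> agree (a i :: 'k) (b i) B"
proof -
  define B where "B x = b (LEAST i. D i \<and> x < a i) x" for x
  have "agree (a i) (b i) B" if "D i" for i
    unfolding agree_def
  proof (intro allI impI)
    fix x assume x: "x < a i"
    let ?l = "LEAST i. D i \<and> x < a i"
    have l: "D ?l \<and> x < a ?l"
      by (rule LeastI) (use x that in blast)
    have "?l \<le> i" using x that by (intro Least_le) simp
    then have "agree (a ?l) (b ?l) (b i)"
      using assms(1) that by blast
    then show "b i x = B x"
      using l by (simp add: agree_def B_def)
  qed
  then show ?thesis by blast
qed

text \<open>The minimal directions from \<open>splitting_tree_cone\<close> cohere along the chain
  and glue to one direction \<open>B\<close>; its node at a level above all the minimal levels
  contains every member.\<close>

lemma splitting_tree_lub: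
  assumes h: "\<And>i. i < d \<Longrightarrow> h i \<in> splitting_tree m"
    and chain: "\<And>i j. i \<le> j \<Longrightarrow> j < d \<Longrightarrow> h i \<le> h j"
  shows "seq_lub d h \<in> splitting_tree m"
proof -
  define Q where "Q w a b \<longleftrightarrow> w \<le> m a b \<and> (\<forall>a' b'. w \<le> m a' b' \<longrightarrow> a \<le> a' \<and> agree a b b')"
    for w a b
  have "\<exists>a b. Q (h i) a b" if "i < d" for i
    by (rule splitting_tree_cone[OF h[OF that]]) (unfold Q_def, blast)
  then obtain a b where "\<And>i. i < d \<Longrightarrow> Q (h i) (a i) (b i)"
    by metis
  then have ab: "h i \<le> m (a i) (b i)" "h i \<le> m a' b' \<Longrightarrow> a i \<le> a' \<and> agree (a i) (b i) b'"
    if "i < d" for i a' b'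
    using that unfolding Q_def by blast+
  have "a i \<le> a j \<and> agree (a i) (b i) (b j)" if "i \<le> j" "j < d" for i j
  proof -
    have "h i \<le> m (a j) (b j)"
      using chain[OF that] ab(1)[OF that(2)] by (rule order_trans)
    then show ?thesis
      using ab(2) that by (meson le_less_trans)
  qed
  then obtain B where B: "\<forall>i. i < d \<longrightarrow> agree (a i) (b i) B"
    using cones_union[of "\<lambda>i. i < d" a b] by (auto intro: le_less_trans)
  obtain A where A: "\<forall>i<d. a i < A"
    using regular by blast
  have "h i \<le> m A B" if "i < d" for i
  proof -
    have "h i \<le> m (a i) B"
      using ab(1)[OF that] m_agree B that by metis
    also have "\<dots> \<le> m A B"
      using A that by (intro m_mono) (simp add: less_imp_le)
    finally show ?thesis .
  qed
  then have "seq_lub d h \<le> m A B"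
    using chain by (intro seq_lub_least) auto
  then show ?thesis by (auto simp: splitting_tree_def)
qed

lemma splitting_tree_branch:
  assumes x: "\<And>a. fun_restrict x a \<in> splitting_tree m"
  shows "\<exists>b. \<forall>a. x \<in> basic_open (seq_snoc (m a b) (b a))"
proof -
  define Q where "Q w a b \<longleftrightarrow> w \<le> m a b \<and> (\<forall>a' b'. w \<le> m a' b' \<longrightarrow> a \<le> a' \<and> agree a b b')"
    for w a b
  have "\<exists>a b. Q (fun_restrict x i) a b" for i
    by (rule splitting_tree_cone[OF x[of i]]) (unfold Q_def, blast)
  then obtain a b where "\<And>i. Q (fun_restrict x i) (a i) (b i)"
    by metis
  then have ab: "fun_restrict x i \<le> m (a i) (b i)"
    "fun_restrict x i \<le> m a' b' \<Longrightarrow> a i \<le> a' \<and> agree (a i) (b i) b'" for i a' b'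
    unfolding Q_def by blast+
  have mono: "a i \<le> a j \<and> agree (a i) (b i) (b j)" if "i \<le> j" for i j
  proof -
    have "fun_restrict x i \<le> fun_restrict x j"
      using that by (simp add: le_fun_restrict_iff)
    then show ?thesis
      using ab by (meson order_trans)
  qed
  obtain B where B: "\<And>i. agree (a i) (b i) B"
    using cones_union[of "\<lambda>_. True" a b] mono by auto
  have xB: "fun_restrict x i \<le> m (a i) B" for i
    using ab(1) m_agree[OF B] by metis
  have "x \<in> basic_open (seq_snoc (m c B) (B c))" for c
  proof -
    \<comment> \<open>If the minimal levels were bounded by \<open>c\<close>, the single node
      \<open>m c B\<close> would contain initial segments of \<open>x\<close> longer than
      itself.\<close>
    have "\<exists>i. c < a i"
    proof (rule ccontr)
      assume "\<nexists>i. c < a i"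
      then have "a i \<le> c" for i by (simp add: not_less)
      then have "fun_restrict x i \<le> m c B" for i
        using xB m_mono by (meson order_trans)
      from seq_le_lengthD[OF this[of "Succ (seq_length (m c B))"]] show False
        using less_Succ[of "seq_length (m c B)"] by simp
    qed
    then obtain i where i: "c < a i" by blast
    have no: "\<not> fun_restrict x i \<le> m c B"
      using ab(2)[of i c B] i by (auto simp: leD)
    have sn: "seq_snoc (m c B) (B c) \<le> m (a i) B"
      using i by (rule m_snoc)
    have "m c B \<le> m (a i) B"
      using i by (intro m_mono) simp
    then have "\<not> i \<le> seq_length (m c B)"
      using le_common_comparable[OF xB[of i]] no by auto
    then have "Succ (seq_length (m c B)) \<le> i"
      by (simp add: Succ_def Least_le)
    then have "seq_snoc (m c B) (B c) \<le> fun_restrict x i"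
      using le_common_comparable[OF sn xB] by simp
    then show ?thesis
      by (simp add: le_fun_restrict_iff)
  qed
  then show ?thesis by blast
qed

end

end

section \<open>The scheme guided by a generic point\<close>

text \<open>\<open>M\<close> and \<open>e\<close> are to come from \<open>splitting\<close>: beyond
  \<open>e s j\<close> the images pass \<open>M s\<close> and continue with bit \<open>j\<close>.
  \<open>V\<close> is to come from \<open>pair_extend\<close>, with \<open>V False\<close> and
  \<open>V True\<close> as the two extended conditions.\<close>

locale scheme = kappa K for K :: "'k::wellorder itself" +
  fixes f :: "('k \<Rightarrow> bool) \<Rightarrow> ('k \<Rightarrow> bool)"
    and M :: "('k, bool) seq \<Rightarrow> ('k, bool) seq" and e :: "('k, bool) seq \<Rightarrow> bool \<Rightarrow> ('k, bool) seq"
    and V :: "bool \<Rightarrow> 'k \<Rightarrow> ('k, bool) seq \<Rightarrow> ('k, bool) seq \<Rightarrow> ('k, bool) seq"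
  assumes e_ge: "\<And>s j. s \<le> e s j"
    and f_e: "\<And>s j x. x \<in> basic_open (e s j) \<Longrightarrow> f x \<in> basic_open (seq_snoc (M s) j)"
    and V_ge1: "\<And>a v v'. v \<le> V False a v v'" and V_ge2: "\<And>a v v'. v' \<le> V True a v v'"
begin

definition kpair :: "'k \<times> 'k \<Rightarrow> 'k" where
  "kpair = (SOME f. bij f)"

lemma bij_kpair: "bij kpair"
  unfolding kpair_def using pairing by (rule someI_ex)

text \<open>Cuts the coordinates of a point into kappa many blocks of two rows, one block per level,
  so that overwriting the guess of one level leaves the other guesses alone.\<close>

definition code :: "'k \<Rightarrow> 'k \<Rightarrow> bool \<Rightarrow> 'k" where
  "code a i j = bool_pair (kpair (a, i), j)"

definition block :: "'k \<Rightarrow> 'k" where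
  "block k = fst (inv kpair (fst (inv bool_pair k)))"

lemma block_code [simp]: "block (code a i j) = a"
  using bij_kpair by (simp add: block_def code_def bij_is_inj)

lemma code_bound: "\<exists>c. \<forall>i<a. \<forall>j. code a i j < c"
proof -
  obtain c where "\<forall>i<a. code a i True < c"
    using regular[of a "\<lambda>i. code a i True"] ..
  moreover obtain d where "\<forall>i<a. code a i False < d"
    using regular[of a "\<lambda>i. code a i False"] ..
  ultimately show ?thesis
    by (intro exI[of _ "max c d"]) (simp add: less_max_iff_disj all_bool_eq)
qed

text \<open>At level \<open>a\<close> the point \<open>g\<close> guesses a pair of branches; only the two nodes on these branches
  are extended, into the first \<open>a\<close> dense sets. A generic \<open>g\<close> guesses any two branches
  in the extension correctly at cofinally many levels, as in the proof that \<open>Add(\<kappa>,1)\<close> forces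
  a diamond sequence.\<close>

definition guess :: "bool \<Rightarrow> ('k \<Rightarrow> bool) \<Rightarrow> 'k \<Rightarrow> 'k \<Rightarrow> bool" where
  "guess j g a i = g (code a i j)"

definition node_union :: "('k \<Rightarrow> ('k \<Rightarrow> bool) \<Rightarrow> ('k, bool) seq) \<Rightarrow> 'k \<Rightarrow> ('k \<Rightarrow> bool) \<Rightarrow> ('k, bool) seq" where
  "node_union p a b = seq_lub a (\<lambda>i. e (p i b) (b i))"

text \<open>If the two guesses agree below \<open>a\<close>, the first clause takes precedence.
  Useful levels are those where the guessed directions have already parted; there
  \<open>guess_node\<close> recovers both components of \<open>V\<close>.\<close>

definition node_step ::
  "('k \<Rightarrow> bool) \<Rightarrow> ('k \<Rightarrow> ('k \<Rightarrow> bool) \<Rightarrow> ('k, bool) seq) \<Rightarrow> 'k \<Rightarrow> ('k \<Rightarrow> bool) \<Rightarrow> ('k, bool) seq" where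
  "node_step g p a b =
     (if agree a b (guess False g a)
      then V False a (node_union p a b) (node_union p a (guess True g a))
      else if agree a b (guess True g a)
      then V True a (node_union p a (guess False g a)) (node_union p a b)
      else node_union p a b)"

definition node :: "('k \<Rightarrow> bool) \<Rightarrow> 'k \<Rightarrow> ('k \<Rightarrow> bool) \<Rightarrow> ('k, bool) seq" where
  "node g = (SOME p. \<forall>a. p a = node_step g p a)"

lemma node_union_cong: "(\<And>i. i < a \<Longrightarrow> p i b = q i b') \<Longrightarrow> agree a b b' \<Longrightarrow> node_union p a b = node_union q a b'"
  unfolding node_union_def agree_def by (rule seq_lub_cong) simp

lemma node_eq: "node g a = node_step g (node g) a"
proof -
  have "\<exists>p. \<forall>a. p a = node_step g p a"
  proof (rule wellorder_rec)
    fix p q :: "'k \<Rightarrow> ('k \<Rightarrow> bool) \<Rightarrow> ('k, bool) seq" and a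
    assume *: "\<And>z. z < a \<Longrightarrow> p z = q z"
    have "node_union p a b = node_union q a b" for b
      by (rule node_union_cong) (simp_all add: *)
    then show "node_step g p a = node_step g q a"
      by (simp add: node_step_def fun_eq_iff)
  qed
  then have "\<forall>a. node g a = node_step g (node g) a"
    unfolding node_def by (rule someI_ex)
  then show ?thesis ..
qed

lemma node_agree: "agree a b c \<Longrightarrow> node g a b = node g a c"
proof (induction a arbitrary: b c rule: less_induct)
  case (less a)
  have "node_union (node g) a b = node_union (node g) a c"
    using less by (intro node_union_cong) (auto intro: agree_mono[OF _ less_imp_le])
  moreover have "agree a b x \<longleftrightarrow> agree a c x" for x
    using less(2) by (meson agree_sym agree_trans)
  ultimately show ?case
    by (simp add: node_eq[of g a] node_step_def)
qed

text \<open>Level \<open>a\<close> consults only the guesses of levels c \<le> a, each only below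
  \<open>c\<close>. These coordinates are bounded in kappa, so a condition can decide a whole level;
  this is the source of \<open>modulus\<close>.\<close>

lemma node_local:
  "(\<And>c i j. c \<le> a \<Longrightarrow> i < c \<Longrightarrow> g (code c i j) = g' (code c i j)) \<Longrightarrow> node g a b = node g' a b"
proof (induction a arbitrary: b rule: less_induct)
  case (less a)
  have IH: "node g i b = node g' i b" if "i < a" for i b
    using less that by auto
  have gu: "agree a (guess j g a) (guess j g' a)" for j
    using less(2) by (simp add: agree_def guess_def)
  have nu: "node_union (node g) a b = node_union (node g') a b'" if "agree a b b'" for b b'
    using IH that by (intro node_union_cong) (auto intro: node_agree agree_mono[OF _ less_imp_le])
  have "agree a b (guess j g a) \<longleftrightarrow> agree a b (guess j g' a)" for j
    using gu by (meson agree_sym agree_trans)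
  then show ?case
    using nu[OF agree_refl, of b] nu[OF gu] by (simp add: node_eq[of _ a] node_step_def)
qed

lemma node_union_le: "node_union (node g) a b \<le> node g a b"
  using V_ge1 V_ge2 by (simp add: node_eq[of _ a] node_step_def)

lemma node_mono: "i < a \<Longrightarrow> e (node g i b) (b i) \<le> node g a b"
proof (induction a arbitrary: i rule: less_induct)
  case (less a)
  \<comment> \<open>\<open>seq_lub\<close> is an upper bound only for chains, so that the earlier
    conditions form one has to be known by induction.\<close>
  have "e (node g i b) (b i) \<le> e (node g j b) (b j)" if "i \<le> j" "j < a" for i j
  proof (cases "i = j")
    case False
    then have "e (node g i b) (b i) \<le> node g j b"
      using less(1)[OF that(2)] that(1) by simp
    then show ?thesis using e_ge by (rule order_trans)
  qed simp
  then have "e (node g i b) (b i) \<le> node_union (node g) a b"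
    unfolding node_union_def using less(2) by (intro seq_lub_upper) auto
  then show ?case using node_union_le by (rule order_trans)
qed

section \<open>The tree of splitting nodes of the images\<close>

definition split_node :: "('k \<Rightarrow> bool) \<Rightarrow> 'k \<Rightarrow> ('k \<Rightarrow> bool) \<Rightarrow> ('k, bool) seq" where
  "split_node g a b = M (node g a b)"

lemma split_node_agree: "agree a b c \<Longrightarrow> split_node g a b = split_node g a c"
  unfolding split_node_def by (simp add: node_agree[of a b c])

text \<open>All points in the cone of \<open>node g a b\<close> have images through the earlier node
  and its bit. As two of these images part exactly at the length of \<open>M\<close>, the common
  earlier part cannot be longer than \<open>M\<close>.\<close>

lemma split_node_snoc:
  assumes "i < a"
  shows "seq_snoc (split_node g i b) (b i) \<le> split_node g a b"
proof -
  let ?w = "seq_snoc (split_node g i b) (b i)" and ?s = "node g a b"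
  have w: "f x \<in> basic_open ?w" if "x \<in> basic_open ?s" for x
    unfolding split_node_def using f_e basic_open_mono[OF node_mono[OF assms] that] by blast
  define x where "x j = seq_at (e ?s j)" for j
  have x: "f (x j) \<in> basic_open (seq_snoc (M ?s) j)" "x j \<in> basic_open ?s" for j
    unfolding x_def using f_e seq_at_mem_basic_open basic_open_mono[OF e_ge] by blast+
  have fx: "f (x j) \<in> basic_open (M ?s)" "f (x j) (seq_length (M ?s)) = j" for j
    using x(1)[of j] by (simp_all add: mem_basic_open_snoc)
  have "seq_length ?w \<le> seq_length (M ?s)"
  proof (rule ccontr)
    assume "\<not> ?thesis"
    then have "f (x j) (seq_length (M ?s)) = seq_at ?w (seq_length (M ?s))" for j
      using w[OF x(2)[of j]] unfolding mem_basic_open_iff by (simp only: not_le)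
    then show False using fx(2) by metis
  qed
  then show ?thesis
    using basic_open_le[OF w[OF x(2)] fx(1)] by (simp add: split_node_def)
qed

text \<open>In the extension, \<open>[tree g]\<close> is the perfect set sought.\<close>

definition tree :: "('k \<Rightarrow> bool) \<Rightarrow> ('k, bool) seq set" where
  "tree g = splitting_tree (split_node g)"

lemma tree_mem: "w \<in> tree g \<longleftrightarrow> (\<exists>a b. w \<le> split_node g a b)"
  by (simp add: tree_def splitting_tree_def)

lemma tree_lub:
  assumes "\<And>i. i < d \<Longrightarrow> h i \<in> tree g" "\<And>i j. i \<le> j \<Longrightarrow> j < d \<Longrightarrow> h i \<le> h j"
  shows "seq_lub d h \<in> tree g"
  unfolding tree_def
  by (rule splitting_tree_lub)
    (use split_node_agree split_node_snoc assms in \<open>auto simp: tree_def\<close>)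

lemma tree_branch:
  assumes "\<And>a. fun_restrict x a \<in> tree g"
  shows "\<exists>b. \<forall>a. x \<in> basic_open (seq_snoc (split_node g a b) (b a))"
  by (rule splitting_tree_branch)
    (use split_node_agree split_node_snoc assms in \<open>auto simp: tree_def\<close>)

lemma split_agree:
  assumes "\<And>i. i < a \<Longrightarrow> x \<in> basic_open (seq_snoc (split_node g i b) (b i))"
    and "\<And>i. i < a \<Longrightarrow> x \<in> basic_open (seq_snoc (split_node g i c) (c i))"
  shows "agree a b c"
  by (rule splitting_agree[where m = "split_node g"])
    (use split_node_agree split_node_snoc assms in auto)

lemma le_split_length: "a \<le> seq_length (split_node g a b)"
  by (rule le_m_length) (use split_node_agree split_node_snoc in auto)

lemma branch_point: "\<exists>X. \<forall>a. X \<in> basic_open (node g a b)"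
  using node_mono e_ge by (intro chain_limit) (metis order_le_less order_refl order_trans)

text \<open>Both \<open>x\<close> and \<open>f X\<close> run through all splitting nodes of
  direction \<open>b\<close>, whose lengths are cofinal in kappa.\<close>

lemma branch_image:
  assumes X: "\<And>a. X \<in> basic_open (node g a b)"
    and x: "\<And>a. x \<in> basic_open (seq_snoc (split_node g a b) (b a))"
  shows "x = f X"
proof
  fix i
  have "X \<in> basic_open (e (node g i b) (b i))"
    using basic_open_mono[OF node_mono[OF less_Succ]] X by blast
  then have "f X \<in> basic_open (seq_snoc (split_node g i b) (b i))"
    unfolding split_node_def by (rule f_e)
  moreover have "i < seq_length (seq_snoc (split_node g i b) (b i))"
    using le_split_length[of i g b] by (simp add: less_Succ_iff)
  ultimately show "x i = f X i"
    using x[of i] by (metis mem_basic_open_iff)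
qed

lemma guess_node:
  assumes "agree a (guess False g a) b" "agree a (guess True g a) b'" "\<not> agree a b b'"
  obtains v v' where "V False a v v' = node g a b" "V True a v v' = node g a b'"
proof
  let ?u = "node_union (node g) a"
  have "?u (guess False g a) = ?u b" "?u (guess True g a) = ?u b'"
    using assms by (auto intro!: node_union_cong node_agree intro: agree_mono[OF _ less_imp_le])
  moreover have "\<not> agree a b' (guess False g a)"
    using assms by (meson agree_sym agree_trans)
  ultimately show "V False a (?u b) (?u b') = node g a b" "V True a (?u b) (?u b') = node g a b'"
    using assms by (simp_all add: node_eq[of _ a] node_step_def agree_sym)
qed

end

section \<open>The name of the perfect tree\<close>

lemma f_exI: "persistent (\<phi> x) \<Longrightarrow> \<phi> x p \<Longrightarrow> f_ex \<phi> p"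
  unfolding f_ex_iff persistent_def by blast

lemma f_seq_check:
  assumes "f_eq \<sigma> (check w) p"
  shows "f_seq \<sigma> (seq_length w) p"
proof -
  have mem: "f_mem (i, b) \<sigma> q \<longleftrightarrow> i < seq_length w \<and> seq_at w i = b" if "p \<le> q" for i b q
    using f_eq_check_memD[OF assms that] by (auto simp: Rep_seq_eq)
  have "(f_mem (i, False) \<sigma> \<^bold>\<longleftrightarrow> \<^bold>\<not> f_mem (i, True) \<sigma>) p" if "i < seq_length w" for i
  proof -
    have "\<forall>q\<ge>p. f_mem (i, False) \<sigma> q \<longleftrightarrow> (\<^bold>\<not> f_mem (i, True) \<sigma>) q"
    proof (intro allI impI)
      fix q assume q: "p \<le> q"
      show "f_mem (i, False) \<sigma> q \<longleftrightarrow> (\<^bold>\<not> f_mem (i, True) \<sigma>) q"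
        unfolding f_not_def using that mem[OF q] mem[OF order_trans[OF q]] by auto
    qed
    then show ?thesis by (subst f_iff_iff) simp_all
  qed
  moreover have "(\<^bold>\<not> f_mem (i, b) \<sigma>) p" if "\<not> i < seq_length w" for i b
    using that mem by (simp add: f_not_def)
  ultimately show ?thesis
    by (simp add: f_seq_def f_all_def f_and_iff f_fact_imp_iff)
qed

lemma f_mem_name_mono: "\<sigma> \<subseteq> \<tau> \<Longrightarrow> f_mem e \<sigma> p \<Longrightarrow> f_mem e \<tau> p"
  unfolding f_mem_def by blast

lemma f_eq_refl [simp]: "f_eq \<sigma> \<sigma> p"
  by (simp add: f_eq_iff)

context kappa
begin

lemma name_insert_check: "name_insert (seq_length t, b) (check t) = check (seq_snoc (t :: ('k, bool) seq) b)"
  by (auto simp: name_insert_def check_def Rep_seq_snoc Rep_seq_eq split: if_splits)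

lemma f_not_eqD:
  assumes "f_fun \<sigma> q" "f_fun \<tau> q" "(\<^bold>\<not> f_eq \<sigma> \<tau>) (q :: ('k, bool) seq)"
  obtains i b r where "r \<ge> q" "f_mem (i, b) \<sigma> r" "f_mem (i, \<not> b) \<tau> r"
proof -
  have *: "\<exists>i b r. r \<ge> q \<and> f_mem (i, b) \<sigma> r \<and> f_mem (i, \<not> b) \<tau> r"
    if H: "f_fun \<sigma> q" "f_fun \<tau> q" "q \<le> p" "f_mem e \<sigma> p" "\<not> f_mem e \<tau> p"
    for e p and \<sigma> \<tau> :: "(_, ('k, bool) seq) rel_name"
  proof -
    obtain i b where e: "e = (i, b)" by force
    have "\<not> (\<forall>s\<ge>p. \<exists>r\<ge>s. f_mem e \<tau> r)"
      using H(5) regular_sentenceD[OF regular_mem] by blast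
    then obtain s where s: "s \<ge> p" "\<And>r. r \<ge> s \<Longrightarrow> \<not> f_mem e \<tau> r" by blast
    have "q \<le> s" using H(3) s(1) by (rule order_trans)
    then obtain b' r where r: "r \<ge> s" "f_mem (i, b') \<tau> r"
      using f_fun_total[OF H(2)] by blast
    have "b' = (\<not> b)" using s(2)[OF r(1)] r(2) e by (cases b; cases b') auto
    moreover have "f_mem (i, b) \<sigma> r"
      using H(4) s(1) r(1) unfolding e by (meson f_mem_mono)
    ultimately show ?thesis using r \<open>q \<le> s\<close> by (meson order_trans)
  qed
  have "\<not> f_eq \<sigma> \<tau> q" using assms(3) by (simp add: f_not_def)
  then obtain e p where "q \<le> p" "f_mem e \<sigma> p \<noteq> f_mem e \<tau> p"
    unfolding f_eq_iff by blast
  then consider "f_mem e \<sigma> p" "\<not> f_mem e \<tau> p" | "f_mem e \<tau> p" "\<not> f_mem e \<sigma> p" by blast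
  then show thesis
  proof cases
    case 1
    then show thesis using *[OF assms(1,2) \<open>q \<le> p\<close>] that by blast
  next
    case 2
    then obtain i b r where "r \<ge> q" "f_mem (i, b) \<tau> r" "f_mem (i, \<not> b) \<sigma> r"
      using *[OF assms(2,1) \<open>q \<le> p\<close>] by blast
    then show thesis using that[of r i "\<not> b"] by simp
  qed
qed

end

context scheme
begin

lemma node_modulus: "\<exists>l. \<forall>g g' b. agree l g g' \<longrightarrow> node g a b = node g' a b"
proof -
  have "\<forall>c. \<exists>l. \<forall>i<c. \<forall>j. code c i j < l"
    using code_bound by blast
  then obtain L where L: "\<And>c i j. i < c \<Longrightarrow> code c i j < L c"
    by metis
  obtain l where l: "\<forall>c\<le>a. L c < l"
    using regular_le by blast
  have "node g a b = node g' a b" if "agree l g g'" for g g' b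
  proof (rule node_local)
    fix c i j assume "c \<le> a" "i < c"
    then have "code c i j < l" using L l by (meson less_trans)
    then show "g (code c i j) = g' (code c i j)"
      using that by (simp add: agree_def)
  qed
  then show ?thesis by blast
qed

definition modulus :: "'k \<Rightarrow> 'k" where
  "modulus a = (SOME l. \<forall>g g' b. agree l g g' \<longrightarrow> node g a b = node g' a b)"

lemma split_node_modulus: "agree (modulus a) g g' \<Longrightarrow> split_node g a b = split_node g' a b"
  using someI_ex[OF node_modulus[of a], folded modulus_def] unfolding split_node_def by simp

definition decided :: "('k, bool) seq \<Rightarrow> ('k, bool) seq \<Rightarrow> bool" where
  "decided w p \<longleftrightarrow> (\<forall>g\<in>basic_open p. w \<in> tree g)"

text \<open>The elements are canonical names of ground model sequences, put in by conditions all of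
  whose ground model points \<open>g\<close> have the sequence in \<open>tree g\<close>. Nothing of
  length below kappa is missed because the forcing adds no such sequences, as used in
  \<open>tree_name_chain\<close>.\<close>

definition tree_name :: "('k, ('k, bool) seq) set_name" where
  "tree_name = {(check w, p) | w p. decided w p}"

lemma decided_mono: "decided w p \<Longrightarrow> p \<le> q \<Longrightarrow> decided w q"
  unfolding decided_def using basic_open_mono by blast

lemma f_elem_tree_name:
  "f_elem \<sigma> tree_name p \<longleftrightarrow> (\<forall>q\<ge>p. \<exists>r\<ge>q. \<exists>w. decided w r \<and> f_eq \<sigma> (check w) r)"
proof -
  have "(\<exists>(\<tau>, s)\<in>tree_name. s \<le> r \<and> f_eq \<sigma> \<tau> r) \<longleftrightarrow> (\<exists>w. decided w r \<and> f_eq \<sigma> (check w) r)" for r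
    unfolding tree_name_def using decided_mono by blast
  then show ?thesis by (simp add: f_elem_def)
qed

lemma f_elem_tree_nameI: "decided w p \<Longrightarrow> f_eq \<sigma> (check w) p \<Longrightarrow> f_elem \<sigma> tree_name p"
  unfolding f_elem_tree_name using decided_mono f_eq_mono by blast

lemma tree_name_seq: "f_elem t tree_name q \<Longrightarrow> (\<^bold>\<exists>a. f_seq t a) q"
  unfolding f_ex_iff f_elem_tree_name using f_seq_check by blast

lemma tree_name_nonempty: "(\<^bold>\<exists>t. f_elem t tree_name) q"
proof -
  obtain b :: 'k where b: "\<forall>x. \<not> x < b"
    using wellorder_bottom by blast
  have "fun_restrict undefined b \<le> split_node g a c" for g a c
    using b by (auto simp: seq_le_iff intro: leI)
  then have "decided (fun_restrict undefined b) q"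
    unfolding decided_def tree_mem by blast
  then have "f_elem (check (fun_restrict undefined b)) tree_name q"
    by (rule f_elem_tree_nameI) simp
  then show ?thesis by (intro f_exI) simp
qed

lemma tree_name_restrict:
  assumes "f_elem t tree_name q"
  shows "f_elem (name_restrict t a) tree_name q"
  unfolding f_elem_tree_name
proof (intro allI impI)
  fix p assume "q \<le> p"
  then obtain r w where r: "r \<ge> p" "decided w r" "f_eq t (check w) r"
    using assms unfolding f_elem_tree_name by blast
  have "decided (seq_restrict w a) r"
    using r(2) seq_restrict_le unfolding decided_def tree_mem by (meson order_trans)
  moreover have "f_eq (name_restrict t a) (check (seq_restrict w a)) r"
    using f_eq_check_memD[OF r(3)] by (auto simp: f_eq_iff Rep_seq_restrict restrict_map_def)
  ultimately show "\<exists>r\<ge>p. \<exists>w. decided w r \<and> f_eq (name_restrict t a) (check w) r"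
    using r(1) by blast
qed

text \<open>By \<open>meet_few\<close> one condition identifies all members of the chain with ground
  model sequences. Their union is then a ground model sequence too, and \<open>tree_lub\<close>
  applies at each \<open>g\<close> separately.\<close>

lemma tree_name_chain:
  fixes d :: 'k
  assumes elem: "\<And>i. i < d \<Longrightarrow> f_elem (\<tau> i) tree_name q"
    and chain: "\<And>i j. i \<le> j \<Longrightarrow> j < d \<Longrightarrow> f_subset (\<tau> i) (\<tau> j) q"
  shows "f_elem (\<Union>i\<in>{..<d}. \<tau> i) tree_name q"
  unfolding f_elem_tree_name
proof (intro allI impI)
  fix p assume p: "q \<le> p"
  have "\<exists>r\<ge>p. \<forall>i<d. \<exists>w. decided w r \<and> f_eq (\<tau> i) (check w) r"
  proof (rule meet_few)
    fix i p' assume "i < d" "p \<le> p'"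
    then show "\<exists>r\<ge>p'. \<exists>w. decided w r \<and> f_eq (\<tau> i) (check w) r"
      using elem p unfolding f_elem_tree_name by (meson order_trans)
  next
    fix i p' r assume "\<exists>w. decided w p' \<and> f_eq (\<tau> i) (check w) p'" "p' \<le> r"
    then show "\<exists>w. decided w r \<and> f_eq (\<tau> i) (check w) r"
      using decided_mono f_eq_mono by blast
  qed
  then obtain r w where r: "p \<le> r" and w: "\<And>i. i < d \<Longrightarrow> decided (w i) r"
    "\<And>i. i < d \<Longrightarrow> f_eq (\<tau> i) (check (w i)) r"
    by metis
  have mem: "f_mem (k, b) (\<tau> i) s \<longleftrightarrow> Rep_seq (w i) k = Some b" if "i < d" "r \<le> s" for i s k b
    using f_eq_check_memD[OF w(2)[OF that(1)] that(2)] .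
  have wchain: "w i \<le> w j" if "i \<le> j" "j < d" for i j
    unfolding less_eq_seq_def map_le_def
  proof
    fix k assume "k \<in> dom (Rep_seq (w i))"
    then obtain b where b: "Rep_seq (w i) k = Some b" by blast
    have "f_subset (\<tau> i) (\<tau> j) q" "q \<le> r"
      using chain that p r by auto
    then have "f_mem (k, b) (\<tau> i) r \<longrightarrow> f_mem (k, b) (\<tau> j) r"
      unfolding f_subset_iff by blast
    then show "Rep_seq (w i) k = Rep_seq (w j) k"
      using b mem[of i r k b] mem[of j r k b] that by (simp add: le_less_trans)
  qed
  have "decided (seq_lub d w) r"
    unfolding decided_def
  proof
    fix g assume "g \<in> basic_open r"
    then show "seq_lub d w \<in> tree g"
      using w(1) wchain by (intro tree_lub) (auto simp: decided_def)
  qed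
  moreover have "f_eq (\<Union>i\<in>{..<d}. \<tau> i) (check (seq_lub d w)) r"
    unfolding f_eq_iff
  proof (intro allI impI)
    fix x :: "'k \<times> bool" and s assume s: "r \<le> s"
    obtain k b where x: "x = (k, b)" by force
    have "f_mem x (\<Union>i\<in>{..<d}. \<tau> i) s \<longleftrightarrow> (\<exists>i<d. Rep_seq (w i) k = Some b)"
    proof
      assume "f_mem x (\<Union>i\<in>{..<d}. \<tau> i) s"
      \<comment> \<open>An index \<open>i\<close> is found only at a stronger condition; as the
        named set is the ground model sequence \<open>w i\<close>, the membership forced there is
        simply true.\<close>
      then have "\<exists>s'\<ge>s. \<exists>(e', t)\<in>\<Union>i\<in>{..<d}. \<tau> i. t \<le> s' \<and> x = e'"
        unfolding f_mem_def by (rule allE[of _ s]) simp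
      then obtain s' i t where s': "s' \<ge> s" "i < d" "(x, t) \<in> \<tau> i" "t \<le> s'"
        by auto
      then have "f_mem x (\<tau> i) s'"
        unfolding f_mem_def
      proof (intro allI impI)
        fix q assume "s' \<le> q"
        then have "case (x, t) of (e', s) \<Rightarrow> s \<le> q \<and> x = e'"
          using s'(4) by auto
        then show "\<exists>r\<ge>q. \<exists>(e', s)\<in>\<tau> i. s \<le> r \<and> x = e'"
          using s'(3) by blast
      qed
      then show "\<exists>i<d. Rep_seq (w i) k = Some b"
        using mem[OF s'(2) order_trans[OF s s'(1)]] s'(2) x by blast
    next
      assume "\<exists>i<d. Rep_seq (w i) k = Some b"
      then obtain i where i: "i < d" "f_mem x (\<tau> i) s"
        using mem s x by blast
      show "f_mem x (\<Union>i\<in>{..<d}. \<tau> i) s"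
        by (rule f_mem_name_mono[OF _ i(2)]) (use i(1) in blast)
    qed
    then show "f_mem x (\<Union>i\<in>{..<d}. \<tau> i) s \<longleftrightarrow> f_mem x (check (seq_lub d w)) s"
      using seq_lub_Some_iff[of d w] wchain by (simp add: x)
  qed
  ultimately show "\<exists>r\<ge>p. \<exists>w. decided w r \<and> f_eq (\<Union>i\<in>{..<d}. \<tau> i) (check w) r"
    using r by blast
qed

lemma tree_name_splitting:
  assumes t: "f_elem t tree_name q"
  shows "(\<^bold>\<exists>u. f_elem u tree_name \<^bold>\<and> f_subset t u \<^bold>\<and>
      (\<^bold>\<exists>a. f_seq u a \<^bold>\<and>
        f_elem (name_insert (a, False) u) tree_name \<^bold>\<and> f_elem (name_insert (a, True) u) tree_name)) q"
  unfolding f_ex_iff[of _ q]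
proof (intro allI impI)
  fix p assume "q \<le> p"
  then obtain r w where r: "r \<ge> p" "decided w r" "f_eq t (check w) r"
    using t unfolding f_elem_tree_name by blast
  define g where "g = seq_at r"
  have g: "g \<in> basic_open r" by (simp add: g_def)
  then obtain a b where ab: "w \<le> split_node g a b"
    using r(2) unfolding decided_def tree_mem by blast
  define u where "u = split_node g a b"
  \<comment> \<open>Long enough to extend \<open>r\<close> and to decide all nodes of the levels
    \<open>a\<close> and \<open>Succ a\<close>, hence \<open>u\<close> and both of its
    successors.\<close>
  let ?n = "max (seq_length r) (max (modulus a) (modulus (Succ a)))"
  let ?s = "fun_restrict g ?n"
  have rs: "r \<le> ?s" using g by (simp add: basic_open_extends)
  have same: "split_node g' a c = split_node g a c" "split_node g' (Succ a) c = split_node g (Succ a) c"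
    if "g' \<in> basic_open ?s" for g' c
  proof -
    have ag: "agree ?n g g'" using that by simp
    have "agree (modulus a) g g'"
      by (rule agree_mono[OF ag]) (simp add: le_max_iff_disj)
    moreover have "agree (modulus (Succ a)) g g'"
      by (rule agree_mono[OF ag]) (simp add: le_max_iff_disj)
    ultimately show "split_node g' a c = split_node g a c" "split_node g' (Succ a) c = split_node g (Succ a) c"
      by (simp_all add: split_node_modulus[of _ g g'])
  qed
  have "decided u ?s"
    unfolding decided_def tree_mem u_def using same by (metis order_refl)
  then have "f_elem (check u) tree_name ?s"
    by (rule f_elem_tree_nameI) simp
  moreover have "f_subset t (check u) ?s"
  proof -
    have "f_mem (k, c) (check u) s" if "r \<le> s" "f_mem (k, c) t s" for k c s
      using f_eq_check_memD[OF r(3) that(1), of k c] that(2) ab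
      by (auto simp: u_def less_eq_seq_def map_le_def dom_def)
    then show ?thesis
      unfolding f_subset_iff using rs by (auto intro: order_trans)
  qed
  moreover have "f_elem (name_insert (seq_length u, j) (check u)) tree_name ?s" for j
    unfolding name_insert_check
  proof (rule f_elem_tree_nameI)
    \<comment> \<open>Changing the direction at \<open>a\<close> itself keeps the node of level
      \<open>a\<close> and selects the bit following it.\<close>
    have "agree a b (b(a := j))" by (simp add: agree_def)
    then have "u = split_node g a (b(a := j))"
      unfolding u_def by (rule split_node_agree)
    then have "seq_snoc u j \<le> split_node g (Succ a) (b(a := j))"
      using split_node_snoc[OF less_Succ, of g a "b(a := j)"] by simp
    then show "decided (seq_snoc u j) ?s"
      unfolding decided_def tree_mem using same by metis
  qed simp
  then have "(\<^bold>\<exists>a. f_seq (check u) a \<^bold>\<and> f_elem (name_insert (a, False) (check u)) tree_name \<^bold>\<and>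
      f_elem (name_insert (a, True) (check u)) tree_name) ?s"
    by (intro f_exI[where x = "seq_length u"]) (simp_all add: f_and_iff f_seq_check)
  ultimately show "\<exists>u. \<exists>r\<ge>p. (f_elem u tree_name \<^bold>\<and> f_subset t u \<^bold>\<and>
      (\<^bold>\<exists>a. f_seq u a \<^bold>\<and>
        f_elem (name_insert (a, False) u) tree_name \<^bold>\<and> f_elem (name_insert (a, True) u) tree_name)) r"
    using order_trans[OF r(1) rs] by (auto simp: f_and_iff)
qed

lemma f_perfect_tree_name: "f_perfect_tree tree_name q"
proof -
  have "(\<^bold>\<forall>t. f_elem t tree_name \<^bold>\<longrightarrow> (\<^bold>\<exists>a. f_seq t a)) q"
    using tree_name_seq by (simp add: f_all_def f_imp_iff)
  moreover have "(\<^bold>\<forall>t a. f_elem t tree_name \<^bold>\<longrightarrow> f_elem (name_restrict t a) tree_name) q"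
    using tree_name_restrict by (simp add: f_all_def f_imp_iff)
  moreover have "(\<^bold>\<forall>d. \<^bold>\<forall>\<tau> :: 'k \<Rightarrow> ('k, ('k, bool) seq) rel_name.
         (\<^bold>\<forall>i. f_fact (i < d) \<^bold>\<longrightarrow> f_elem (\<tau> i) tree_name) \<^bold>\<and>
         (\<^bold>\<forall>i j. f_fact (i \<le> j \<and> j < d) \<^bold>\<longrightarrow> f_subset (\<tau> i) (\<tau> j)) \<^bold>\<longrightarrow>
         f_elem (\<Union>i\<in>{..<d}. \<tau> i) tree_name) q"
  proof -
    have "((\<^bold>\<forall>i. f_fact (i < d) \<^bold>\<longrightarrow> f_elem (\<tau> i) tree_name) \<^bold>\<and>
         (\<^bold>\<forall>i j. f_fact (i \<le> j \<and> j < d) \<^bold>\<longrightarrow> f_subset (\<tau> i) (\<tau> j)) \<^bold>\<longrightarrow>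
         f_elem (\<Union>i\<in>{..<d}. \<tau> i) tree_name) q" for d and \<tau> :: "'k \<Rightarrow> ('k, ('k, bool) seq) rel_name"
    proof (subst f_imp_iff)
      show "\<forall>p\<ge>q. ((\<^bold>\<forall>i. f_fact (i < d) \<^bold>\<longrightarrow> f_elem (\<tau> i) tree_name) \<^bold>\<and>
         (\<^bold>\<forall>i j. f_fact (i \<le> j \<and> j < d) \<^bold>\<longrightarrow> f_subset (\<tau> i) (\<tau> j))) p \<longrightarrow>
         f_elem (\<Union>i\<in>{..<d}. \<tau> i) tree_name p"
        using tree_name_chain[of d \<tau>] by (simp add: f_and_iff f_all_def f_fact_imp_iff)
    qed simp_all
    then show ?thesis by (simp add: f_all_def)
  qed
  moreover have "(\<^bold>\<forall>t. f_elem t tree_name \<^bold>\<longrightarrow>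
         (\<^bold>\<exists>u. f_elem u tree_name \<^bold>\<and> f_subset t u \<^bold>\<and>
           (\<^bold>\<exists>a. f_seq u a \<^bold>\<and>
              f_elem (name_insert (a, False) u) tree_name \<^bold>\<and> f_elem (name_insert (a, True) u) tree_name))) q"
    using tree_name_splitting by (simp add: f_all_def f_imp_iff)
  ultimately show ?thesis
    unfolding f_perfect_tree_def f_and_iff using tree_name_nonempty by blast
qed

section \<open>Branches in the extension\<close>

definition is_branch :: "('k \<Rightarrow> bool) \<Rightarrow> ('k \<Rightarrow> bool) \<Rightarrow> ('k \<Rightarrow> bool) \<Rightarrow> bool" where
  "is_branch g x b \<longleftrightarrow> (\<forall>a. x \<in> basic_open (seq_snoc (split_node g a b) (b a)))"

lemma almost_all_branch:
  assumes "f_branch \<sigma> tree_name q"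
  shows "almost_all (\<lambda>g. g \<in> basic_open q \<longrightarrow> (\<forall>x. interp \<sigma> g x \<longrightarrow> (\<exists>b. is_branch g x b)))"
proof -
  have "\<exists>r\<ge>p. \<exists>w. decided w r \<and> f_eq (name_restrict \<sigma> a) (check w) r" if "p \<ge> q" for a p
    using assms that unfolding f_branch_def f_and_iff f_all_def f_elem_tree_name by blast
  then have "almost_all (\<lambda>g. \<forall>a. g \<in> basic_open q \<longrightarrow>
      (\<exists>r. (\<exists>w. decided w r \<and> f_eq (name_restrict \<sigma> a) (check w) r) \<and> g \<in> basic_open r))"
    by (intro almost_all_all almost_all_meets_below)
  then show ?thesis
  proof (rule almost_all_mono, intro impI allI)
    fix g x
    assume *: "\<forall>a. g \<in> basic_open q \<longrightarrow>
      (\<exists>r. (\<exists>w. decided w r \<and> f_eq (name_restrict \<sigma> a) (check w) r) \<and> g \<in> basic_open r)"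
      and g: "g \<in> basic_open q" and x: "interp \<sigma> g x"
    have "fun_restrict x a \<in> tree g" for a
    proof -
      obtain r w where r: "decided w r" "f_eq (name_restrict \<sigma> a) (check w) r" "g \<in> basic_open r"
        using * g by blast
      then have "w = fun_restrict x a" using x by (metis interp_check)
      then show ?thesis using r(1,3) by (simp add: decided_def)
    qed
    then show "\<exists>b. is_branch g x b"
      unfolding is_branch_def by (rule tree_branch)
  qed
qed

section \<open>Guessing pairs of branches\<close>

text \<open>At a closure point \<open>a\<close>, the conditions evaluating \<open>x\<close>, the
  splitting nodes and their moduli for indices below \<open>a\<close> all stay below
  \<open>a\<close>. Hence \<open>g\<close> below \<open>a\<close> determines the direction below
  \<open>a\<close>, and the rest of \<open>g'\<close>, including the guess of level
  \<open>a\<close>, may be arbitrary.\<close>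

lemma branch_stable:
  assumes fs: "f_fun \<sigma> q" "g' \<in> basic_open q" and ag: "agree a g g'"
    and P: "\<And>k. g \<in> basic_open (P k)" "\<And>k. f_mem (k, x k) \<sigma> (P k)"
      "\<And>k. k < a \<Longrightarrow> seq_length (P k) < a"
    and b: "is_branch g x b" "\<And>k. k < a \<Longrightarrow> seq_length (split_node g k b) < a"
    and md: "\<And>k. k < a \<Longrightarrow> modulus k < a"
    and x': "interp \<sigma> g' x'" and b': "is_branch g' x' b'"
  shows "agree a b b'"
proof (rule split_agree)
  fix k assume k: "k < a"
  have ax: "x i = x' i" if "i < a" for i
  proof -
    have "g' \<in> basic_open (P i)"
      using P(1) agree_mono[OF ag less_imp_le[OF P(3)[OF that]]] by (rule mem_basic_open_agree)
    then show ?thesis using interp_mem[OF fs x' _ P(2)] by metis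
  qed
  have "split_node g k b = split_node g' k b"
    using agree_mono[OF ag less_imp_le[OF md[OF k]]] by (rule split_node_modulus)
  moreover have "x' \<in> basic_open (seq_snoc (split_node g k b) (b k))"
  proof (rule mem_basic_open_agree)
    show "x \<in> basic_open (seq_snoc (split_node g k b) (b k))"
      using b(1) by (simp add: is_branch_def)
    show "agree (seq_length (seq_snoc (split_node g k b) (b k))) x x'"
      using ax b(2)[OF k] by (auto simp: agree_def less_Succ_iff)
  qed
  ultimately show "x' \<in> basic_open (seq_snoc (split_node g' k b) (b k))" by simp
  show "x' \<in> basic_open (seq_snoc (split_node g' k b') (b' k))"
    using b' by (simp add: is_branch_def)
qed

definition pos :: "'k \<Rightarrow> 'k" where
  "pos k = snd (inv kpair (fst (inv bool_pair k)))"

lemma pos_code [simp]: "pos (code a i j) = i" "snd (inv bool_pair (code a i j)) = j"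
  using bij_kpair by (simp_all add: pos_def code_def bij_is_inj)

definition guessed :: "'k Add_name \<Rightarrow> 'k Add_name \<Rightarrow> 'k \<Rightarrow> ('k \<Rightarrow> bool) \<Rightarrow> bool" where
  "guessed \<sigma> \<tau> i g \<longleftrightarrow> (\<forall>x y b c. interp \<sigma> g x \<longrightarrow> interp \<tau> g y \<longrightarrow> is_branch g x b \<longrightarrow>
     is_branch g y c \<longrightarrow> (\<exists>a\<ge>i. agree a (guess False g a) b \<and> agree a (guess True g a) c))"

text \<open>The density argument for diamond: evaluate both names at some \<open>g\<close> through
  \<open>p\<close>, close off to \<open>a\<close>, and overwrite block \<open>a\<close> with the
  directions found. By \<open>branch_stable\<close> these persist below \<open>a\<close> at every
  point of the new condition, so its guess is right.\<close>

lemma almost_all_guessed: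
  assumes fs: "f_fun \<sigma> q" and ft: "f_fun \<tau> q"
    and ae: "almost_all (\<lambda>g. g \<in> basic_open q \<longrightarrow>
      (\<exists>x y b c. interp \<sigma> g x \<and> interp \<tau> g y \<and> is_branch g x b \<and> is_branch g y c))"
  shows "almost_all (\<lambda>g. g \<in> basic_open q \<longrightarrow> guessed \<sigma> \<tau> i g)"
proof -
  have "\<exists>r\<ge>p. \<forall>g\<in>basic_open r. g \<in> basic_open q \<longrightarrow> guessed \<sigma> \<tau> i g" if p: "p \<ge> q" for p
  proof -
    obtain g where gp: "g \<in> basic_open p" and "g \<in> basic_open q \<longrightarrow>
      (\<exists>x y b c. interp \<sigma> g x \<and> interp \<tau> g y \<and> is_branch g x b \<and> is_branch g y c)"
      using ae by (rule baire)
    moreover have "g \<in> basic_open q"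
      using p gp by (rule basic_open_mono)
    ultimately obtain x y b c where xy: "interp \<sigma> g x" "interp \<tau> g y"
      and bc: "is_branch g x b" "is_branch g y c"
      by blast
    obtain P where P: "\<And>k. g \<in> basic_open (P k)" "\<And>k. f_mem (k, x k) \<sigma> (P k)"
      using xy(1) unfolding interp_def by metis
    obtain Q where Q: "\<And>k. g \<in> basic_open (Q k)" "\<And>k. f_mem (k, y k) \<tau> (Q k)"
      using xy(2) unfolding interp_def by metis
    \<comment> \<open>Including \<open>block k\<close> ensures that no coordinate below
      \<open>a\<close> belongs to block \<open>a\<close>, so overwriting that block does not change
      \<open>g\<close> below \<open>a\<close>.\<close>
    define h where "h k = Max {seq_length (P k), seq_length (Q k), seq_length (split_node g k b),
        seq_length (split_node g k c), modulus k, block k}" for k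
    obtain a where "max i (seq_length p) < a \<and> (\<forall>k<a. h k < a)"
      using closure_point ..
    then have a: "max i (seq_length p) < a" "\<And>k. k < a \<Longrightarrow> h k < a"
      by simp_all
    have h: "seq_length (P k) < a" "seq_length (Q k) < a" "seq_length (split_node g k b) < a"
      "seq_length (split_node g k c) < a" "modulus k < a" "block k < a" if "k < a" for k
      using a(2)[OF that] by (simp_all add: h_def)
    define g1 where "g1 k = (if block k = a then
        (if snd (inv bool_pair k) then c (pos k) else b (pos k)) else g k)" for k
    have ag: "agree a g g1"
      using h(6) by (auto simp: agree_def g1_def)
    have g1: "g1 (code a k False) = b k" "g1 (code a k True) = c k" for k
      by (simp_all add: g1_def)
    obtain n where n: "\<forall>k<a. \<forall>j. code a k j < n"
      using code_bound by blast
    \<comment> \<open>The bound \<open>n\<close> makes the condition contain the part below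
      \<open>a\<close> of both guesses of level \<open>a\<close>.\<close>
    let ?r = "fun_restrict g1 (max a n)"
    have "agree (seq_length p) g g1"
      using ag a(1) by (auto intro: agree_mono)
    with gp have "g1 \<in> basic_open p" by (rule mem_basic_open_agree)
    then have "p \<le> ?r"
      using a(1) by (intro basic_open_extends) (auto simp: le_max_iff_disj)
    moreover have "guessed \<sigma> \<tau> i g'" if g': "g' \<in> basic_open ?r" "g' \<in> basic_open q" for g'
      unfolding guessed_def
    proof (intro allI impI)
      fix x' y' b' c'
      assume int: "interp \<sigma> g' x'" "interp \<tau> g' y'" and br: "is_branch g' x' b'" "is_branch g' y' c'"
      have ag': "agree (max a n) g1 g'" using g'(1) by simp
      then have "agree a g g'"
        using ag by (meson agree_mono agree_trans max.cobounded1)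
      then have "agree a b b'" "agree a c c'"
        using branch_stable[OF fs g'(2) _ P h(1) bc(1) h(3) h(5) int(1) br(1)]
          branch_stable[OF ft g'(2) _ Q h(2) bc(2) h(4) h(5) int(2) br(2)] by blast+
      moreover have "g' (code a k j) = g1 (code a k j)" if "k < a" for k j
        using ag' n that by (simp add: agree_def less_max_iff_disj)
      ultimately have "agree a (guess False g' a) b'" "agree a (guess True g' a) c'"
        by (simp_all add: agree_def guess_def g1)
      then show "\<exists>a\<ge>i. agree a (guess False g' a) b' \<and> agree a (guess True g' a) c'"
        using a(1) by (intro exI[of _ a]) (simp add: less_imp_le)
    qed
    ultimately show ?thesis by blast
  qed
  then have "almost_all (\<lambda>g. g \<in> basic_open q \<longrightarrow>
      (\<exists>r. (\<forall>g\<in>basic_open r. g \<in> basic_open q \<longrightarrow> guessed \<sigma> \<tau> i g) \<and> g \<in> basic_open r))"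
    by (rule almost_all_meets_below)
  then show ?thesis by (rule almost_all_mono) blast
qed

text \<open>\<open>X\<close> and \<open>Y\<close> are built from \<open>g\<close>, and the guesses
  bring their pair into the sets \<open>U i\<close>: each \<open>i\<close> lies below a level where
  the two directions have parted and are both guessed correctly. So \<open>G\<close>, with halves
  \<open>X\<close> and \<open>Y\<close>, contradicts the evaluated equivalence.\<close>

lemma branches_inequivalent:
  assumes V: "\<And>a v v' g i. half False g \<in> basic_open (V False a v v') \<Longrightarrow>
      half True g \<in> basic_open (V True a v v') \<Longrightarrow> i \<le> a \<Longrightarrow> g \<in> U i"
    and U: "\<And>g. (\<forall>i. g \<in> U i) \<Longrightarrow> (f (half False g), f (half True g)) \<notin> tree_proj T"
    and tree: "is_tree T"
    and bs: "f_branch \<sigma> tree_name q" and bt: "f_branch \<tau> tree_name q"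
    and ne: "(\<^bold>\<not> f_eq \<sigma> \<tau>) q"
  shows "\<not> f_proj T \<sigma> \<tau> q"
proof
  assume proj: "f_proj T \<sigma> \<tau> q"
  have "f_fun \<sigma> q" "f_fun \<tau> q"
    using bs bt by (simp_all add: f_branch_def f_and_iff)
  then obtain i b0 r where r: "r \<ge> q" "f_mem (i, b0) \<sigma> r" "f_mem (i, \<not> b0) \<tau> r"
    using f_not_eqD[OF _ _ ne] by metis
  have fr: "f_fun \<sigma> r" "f_fun \<tau> r" "f_branch \<sigma> tree_name r" "f_branch \<tau> tree_name r" "f_proj T \<sigma> \<tau> r"
    using bs bt \<open>f_fun \<sigma> q\<close> \<open>f_fun \<tau> q\<close> proj r(1)
    by (auto intro: persistentD[OF regular_persistent])
  have ae: "almost_all (\<lambda>g. g \<in> basic_open r \<longrightarrow> (\<exists>x y b c. interp \<sigma> g x \<and> interp \<tau> g y \<and>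
      is_branch g x b \<and> is_branch g y c \<and> (x, y) \<in> tree_proj T))"
    using almost_all_conj[OF almost_all_proj[OF tree fr(5)]
        almost_all_conj[OF almost_all_branch[OF fr(3)] almost_all_branch[OF fr(4)]]]
    by (rule almost_all_mono) blast
  have "almost_all (\<lambda>g. \<forall>i. g \<in> basic_open r \<longrightarrow> guessed \<sigma> \<tau> i g)"
    by (intro almost_all_all almost_all_guessed fr(1,2) almost_all_mono[OF ae]) blast
  from almost_all_conj[OF ae this] obtain g x y b c where g: "g \<in> basic_open r"
    and gu: "\<And>i. guessed \<sigma> \<tau> i g" and xy: "interp \<sigma> g x" "interp \<tau> g y"
    and bc: "is_branch g x b" "is_branch g y c" and E: "(x, y) \<in> tree_proj T"
    by (rule baire[of _ r]) blast
  obtain X Y where X: "\<And>a. X \<in> basic_open (node g a b)" and Y: "\<And>a. Y \<in> basic_open (node g a c)"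
    using branch_point by metis
  have fX: "x = f X" "y = f Y"
    using branch_image[OF X] branch_image[OF Y] bc unfolding is_branch_def by blast+
  have "x i = b0" "y i = (\<not> b0)"
    using interp_mem[OF fr(1) g xy(1) g r(2)] interp_mem[OF fr(2) g xy(2) g r(3)] .
  then have "x \<noteq> y" by auto
  have "b \<noteq> c"
  proof
    assume "b = c"
    then have "y = f X"
      using branch_image[OF X] bc(2) unfolding is_branch_def by blast
    with fX(1) \<open>x \<noteq> y\<close> show False by simp
  qed
  then obtain d where d: "b d \<noteq> c d" by blast
  define G where "G k = (case inv bool_pair k of (i, j) \<Rightarrow> if j then Y i else X i)" for k
  have G: "half False G = X" "half True G = Y"
    by (auto simp: fun_eq_iff half_def G_def)
  have "G \<in> U i" for i
  proof -
    \<comment> \<open>Beyond \<open>i\<close>, so that this level treats \<open>U i\<close>, and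
      beyond a difference \<open>d\<close> of the directions, so that \<open>guess_node\<close>
      applies.\<close>
    obtain a where a: "a \<ge> max i (Succ d)" "agree a (guess False g a) b" "agree a (guess True g a) c"
      using gu[of "max i (Succ d)"] xy bc unfolding guessed_def by blast
    have "d < a" using a(1) less_Succ less_le_trans by auto
    then have "\<not> agree a b c" using d by (auto simp: agree_def)
    then obtain v v' where "V False a v v' = node g a b" "V True a v v' = node g a c"
      using guess_node[OF a(2,3)] by blast
    then show ?thesis
      using V[of G a v v' i] X[of a] Y[of a] a(1) by (simp add: G)
  qed
  then show False
    using U[of G] E by (simp add: G fX)
qed

end

context kappa
begin

lemma hom_imp_perfect_inequivalent:
  fixes T T' :: "'k triple set"
  assumes bi: "strongly_bianalytic_via T T' E" and E: "equiv UNIV E"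
    and S: "upwards_dense S" and f: "continuous_below f"
    and hom: "graph_hom (G0 S) (G_E E) f"
  shows "f_perfect_inequivalent (\<lambda>x y :: 'k Add_name. f_proj T x y) p"
proof -
  have T: "is_tree T" "E = tree_proj T"
    using bi by (simp_all add: strongly_bianalytic_via_def)
  have "\<forall>s. \<exists>M e. \<forall>j. s \<le> e j \<and> (\<forall>x\<in>basic_open (e j). f x \<in> basic_open (seq_snoc (M :: ('k, bool) seq) j))"
    using splitting[OF E S f hom] by blast
  then obtain M e where Me: "\<And>s j. s \<le> e s j"
    "\<And>s j x. x \<in> basic_open (e s j) \<Longrightarrow> f x \<in> basic_open (seq_snoc (M s :: ('k, bool) seq) j)"
    by metis
  obtain U :: "'k \<Rightarrow> _" where "(\<forall>i. dense_open (U i)) \<and>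
      (\<forall>g. (\<forall>i. g \<in> U i) \<longrightarrow> (f (half False g), f (half True g)) \<notin> E)"
    using almost_all_halves_inequivalent[OF bi E S f hom] unfolding almost_all_def ..
  then have U: "dense_open (U i)" "(\<forall>i. g \<in> U i) \<Longrightarrow> (f (half False g), f (half True g)) \<notin> E" for i g
    by simp_all
  define R where "R a v v' w w' \<longleftrightarrow> v \<le> w \<and> v' \<le> w' \<and>
    (\<forall>g. half False g \<in> basic_open w \<longrightarrow> half True g \<in> basic_open w' \<longrightarrow> (\<forall>i\<le>a. g \<in> U i))"
    for a v v' w w'
  have "\<exists>w w'. R a v v' w w'" for a v v'
    unfolding R_def using U(1) by (rule pair_extend)
  then obtain W W' where W: "\<And>a v v'. R a v v' (W a v v') (W' a v v')"
    by metis
  define V where "V j = (if j then W' else W)" for j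
  interpret scheme K f M e V
    by unfold_locales (use Me W in \<open>auto simp: V_def R_def\<close>)
  have V: "g \<in> U i" if "half False g \<in> basic_open (V False a v v')"
    "half True g \<in> basic_open (V True a v v')" "i \<le> a" for a v v' g i
    using that W[of a v v'] by (auto simp: V_def R_def)
  have "(f_branch x tree_name \<^bold>\<and> f_branch y tree_name \<^bold>\<and> \<^bold>\<not> f_eq x y \<^bold>\<longrightarrow> \<^bold>\<not> f_proj T x y) q" for x y q
  proof (subst f_imp_iff)
    show "\<forall>r\<ge>q. (f_branch x tree_name \<^bold>\<and> f_branch y tree_name \<^bold>\<and> \<^bold>\<not> f_eq x y) r \<longrightarrow> (\<^bold>\<not> f_proj T x y) r"
    proof (intro allI impI)
      fix r assume *: "(f_branch x tree_name \<^bold>\<and> f_branch y tree_name \<^bold>\<and> \<^bold>\<not> f_eq x y) r"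
      have "\<not> f_proj T x y s" if "r \<le> s" for s
      proof (rule branches_inequivalent[OF V _ T(1)])
        show "f_branch x tree_name s" "f_branch y tree_name s" "(\<^bold>\<not> f_eq x y) s"
          using * that unfolding f_and_iff
          by (auto intro: persistentD[OF regular_persistent] persistentD[OF persistent_not])
        show "(f (half False g), f (half True g)) \<notin> tree_proj T" if "\<forall>i. g \<in> U i" for g
          using U(2)[OF that] T(2) by blast
      qed
      then show "(\<^bold>\<not> f_proj T x y) r" by (simp add: f_not_def)
    qed
  qed simp_all
  then have "(f_perfect_tree tree_name \<^bold>\<and>
      (\<^bold>\<forall>x y. f_branch x tree_name \<^bold>\<and> f_branch y tree_name \<^bold>\<and> \<^bold>\<not> f_eq x y \<^bold>\<longrightarrow> \<^bold>\<not> f_proj T x y)) q" for q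
    using f_perfect_tree_name by (simp add: f_and_iff f_all_def)
  then show ?thesis
    unfolding f_perfect_inequivalent_def f_ex_iff[of _ p] by blast
qed

end

theorem lemma5p5:
  fixes E :: "(('k::wellorder \<Rightarrow> bool) \<times> ('k \<Rightarrow> bool)) set"
    and T T' :: "'k triple set"
    and S :: "('k, bool) seq set"
  assumes "uncountable_cardinal TYPE('k)"
    and "weak_power_eq TYPE('k)"
    and "upwards_dense S"
    and "\<forall>s\<in>S. \<forall>t\<in>S. seq_length s = seq_length t \<longrightarrow> s = t"
    and "equiv UNIV E"
    and "strongly_bianalytic_via T T' E"
    and "silver_fails_in_some_Add_extension T"
  shows "(\<nexists>c. kappa_borel_coloring (G_E E) c) \<and>
         (\<nexists>f. continuous_map bounded_topology bounded_topology f \<and> graph_hom (G0 S) (G_E E) f)"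
proof -
  interpret kappa "TYPE('k)"
    using assms(1,2) by unfold_locales
  let ?R = "\<lambda>x y :: 'k Add_name. f_proj T x y"
  obtain p where p: "\<And>q. p \<le> q \<Longrightarrow> \<not> f_silver ?R q"
    using assms(7) unfolding silver_fails_in_some_Add_extension_def in_some_Add_extension_def f_not_def
    by blast
  have 1: "\<not> f_at_most_kappa_classes ?R p"
  proof
    assume "f_at_most_kappa_classes ?R p"
    then have "f_silver ?R p"
      unfolding f_silver_def
      by (intro f_orI1 regular_persistent) (simp_all add: f_at_most_kappa_classes_def)
    with p show False by blast
  qed
  have 2: "\<not> f_perfect_inequivalent ?R p"
  proof
    assume "f_perfect_inequivalent ?R p"
    then have "f_silver ?R p"
      unfolding f_silver_def
      by (intro f_orI2 regular_persistent) (simp_all add: f_perfect_inequivalent_def)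
    with p show False by blast
  qed
  have "\<not> kappa_borel_coloring (G_E E) c" for c
  proof
    assume "kappa_borel_coloring (G_E E) c"
    then have "c x \<noteq> c y" if "(x, y) \<notin> E" for x y
      using that unfolding kappa_borel_coloring_def G_E_def by blast
    then have "f_at_most_kappa_classes ?R p"
      by (rule coloring_imp_at_most_kappa_classes[OF assms(6)])
    with 1 show False ..
  qed
  moreover have "\<not> (continuous_map bounded_topology bounded_topology f \<and> graph_hom (G0 S) (G_E E) f)" for f
    using hom_imp_perfect_inequivalent[OF assms(6,5,3) continuous_map_imp_below] 2 by blast
  ultimately show ?thesis by blast
qed

end
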